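(* Let $A$ be a Lie algebroid over a smooth manifold $M$, and let $\pi,\pi'\in\Gamma(\wedge^2A)$ be bivectors. The torsion of the relation $\mathbf N(\pi,\pi')$ satisfies $$2\,\mathbf T(\mathbf N(\pi,\pi'))(\xi_1,\xi_2,\xi,\xi',\xi'')=\langle\xi,[\pi,\pi](\xi_1,\xi_2)\rangle+\langle\xi'',[\pi',\pi'](\xi_1,\xi_2)\rangle-2\langle\xi',[\pi,\pi'](\xi_1,\xi_2)\rangle$$ for all $\xi_1,\xi_2,\xi,\xi',\xi''\in\Gamma(A^* )$ such that $\pi\xi=\pi'\xi'$ and $\pi\xi'=\pi'\xi''$.
   Context: $[~,~]$ denotes the Lie algebroid bracket on $\Gamma A$, and also the Schouten--Nijenhuis bracket on $\Gamma(\wedge^\bullet A)$. A bivector $\pi\in\Gamma(\wedge^2A)$ is identified with the map $\pi:A^*\to A$, $\pi\xi=i_\xi\pi$, i.e. $\langle\eta,\pi\xi\rangle=\pi(\xi,\eta)$, and with the induced map on sections. Set $[\xi_1,\xi_2]_\pi=\mathcal L_{\pi\xi_1}\xi_2-\mathcal L_{\pi\xi_2}\xi_1-\mathrm d(\pi(\xi_1,\xi_2))$, where $\mathrm d$ is the Lie algebroid differential and $\mathcal L$ the Lie derivative. The trivector $[\pi,\pi']$ is viewed as a map $\Gamma(A^* )\times\Gamma(A^* )\to\Gamma A$, with sign conventions such that $\frac12[\pi,\pi](\xi_1,\xi_2)=[\pi\xi_1,\pi\xi_2]-\pi[\xi_1,\xi_2]_\pi$ for every bivector $\pi$; $[\pi,\pi']$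 is symmetric and bilinear in $(\pi,\pi')$, so this determines $[\pi,\pi'](\xi_1,\xi_2)$ by polarization. Relations are taken at the level of sections. For a relation $\mathbf N\subset\Gamma A\times\Gamma A$, the dual relation is $\mathbf N^*=\{(\beta,\alpha)\in\Gamma(A^* )\times\Gamma(A^* )\mid\langle\alpha,u\rangle=\langle\beta,v\rangle\ \forall(u,v)\in\mathbf N\}$. The torsion of $\mathbf N$ is the function $$\mathbf T(\mathbf N)(u_1,v_1,u_2,v_2,\alpha,\alpha',\alpha'')=\langle\alpha,[v_1,v_2]\rangle-\langle\alpha',[v_1,u_2]+[u_1,v_2]\rangle+\langle\alpha'',[u_1,u_2]\rangle\in C^\infty(M)$$ defined for $(u_1,v_1),(u_2,v_2)\in\mathbf N$ and $(\alpha,\alpha'),(\alpha',\alpha'')\in\mathbf N^*$. For bivectors $\pi,\pi'$, $\mathbf N(\pi,\pi')=\{(\pi'\xi,\pi\xi)\mid\xi\in\Gamma(A^* )\}$, whose dual is $\mathbf N(\pi,\pi')^*=\{(\xi,\xi')\mid\pi\xi=\pi'\xi'\}$. One writes $\mathbf T(\mathbf N(\pi,\pi'))(\xi_1,\xi_2,\xi,\xi',\xi'')$ for $\mathbf T(\mathbf N(\pi,\pi'))(\pi'\xi_1,\pi\xi_1,\pi'\xi_2,\pi\xi_2,\xi,\xi',\xi'')$. *)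

theory Defs
  imports "HOL-Analysis.Analysis"
begin

section \<open>Smooth manifolds\<close>

text \<open>
  The model space of a manifold is a linear subspace \<open>E\<close> of a Euclidean space, rather than the
  whole type, because every type of class \<open>euclidean_space\<close> has positive dimension and
  zero-dimensional manifolds (for which Lie algebroids are just Lie algebras) must not be lost.
  In \<open>Ck_on\<close> the set \<open>S\<close> is meant to be relatively open in \<open>E\<close>; then \<open>D x v\<close> is uniquely
  determined for \<open>x \<in> S\<close> and \<open>v \<in> E\<close>, namely it is the directional derivative of \<open>f\<close> at \<open>x\<close>.
\<close>

primrec Ck_on ::
  "nat \<Rightarrow> 'e::real_normed_vector set \<Rightarrow> 'e set \<Rightarrow> ('e \<Rightarrow> 'b::real_normed_vector) \<Rightarrow> bool" where
  "Ck_on 0 E S f \<longleftrightarrow> continuous_on S f"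
| "Ck_on (Suc k) E S f \<longleftrightarrow>
     (\<exists>D. (\<forall>x\<in>S. (f has_derivative D x) (at x within S)) \<and> (\<forall>v\<in>E. Ck_on k E S (\<lambda>x. D x v)))"

definition Cinf_on ::
  "'e::real_normed_vector set \<Rightarrow> 'e set \<Rightarrow> ('e \<Rightarrow> 'b::real_normed_vector) \<Rightarrow> bool" where
  "Cinf_on E S f \<longleftrightarrow> (\<forall>k. Ck_on k E S f)"

text \<open>
  The manifold \<open>M\<close> is the whole type \<open>'m\<close>; Hausdorff and second countable are imposed by the sort
  of \<open>'m\<close> in \<open>smooth_manifold\<close>. A chart is a pair of its domain and its coordinate map.
\<close>

record ('m, 'e) manifold_data =
  model :: "'e set"
  atlas :: "('m set \<times> ('m \<Rightarrow> 'e)) set"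

definition smooth_manifold ::
  "('m::{t2_space, second_countable_topology}, 'e::euclidean_space, 'z) manifold_data_scheme \<Rightarrow> bool"
where
  "smooth_manifold M \<longleftrightarrow>
     subspace (model M) \<and>
     (\<Union>(U, \<phi>)\<in>atlas M. U) = UNIV \<and>
     (\<forall>(U, \<phi>)\<in>atlas M.
        open U \<and> openin (top_of_set (model M)) (\<phi> ` U) \<and>
        homeomorphism U (\<phi> ` U) \<phi> (inv_into U \<phi>)) \<and>
     (\<forall>(U, \<phi>)\<in>atlas M. \<forall>(V, \<psi>)\<in>atlas M.
        Cinf_on (model M) (\<phi> ` (U \<inter> V)) (\<psi> \<circ> inv_into U \<phi>))"

definition smooth_fun_on ::
  "('m, 'e::euclidean_space, 'z) manifold_data_scheme \<Rightarrow> 'm set \<Rightarrow> ('m \<Rightarrow> real) \<Rightarrow> bool" where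
  "smooth_fun_on M W f \<longleftrightarrow>
     (\<forall>(U, \<phi>)\<in>atlas M. Cinf_on (model M) (\<phi> ` (U \<inter> W)) (f \<circ> inv_into U \<phi>))"

abbreviation smooth_fun ::
  "('m, 'e::euclidean_space, 'z) manifold_data_scheme \<Rightarrow> ('m \<Rightarrow> real) \<Rightarrow> bool" where
  "smooth_fun M \<equiv> smooth_fun_on M UNIV"

text \<open>
  Tangent vectors are derivations of \<open>C\<^sup>\<infinity>(M)\<close> at \<open>x\<close>. They are represented by functionals on all
  functions \<open>'m \<Rightarrow> real\<close>, of which only the values on smooth functions are meaningful.
\<close>

definition tangent_vectors ::
  "('m, 'e::euclidean_space, 'z) manifold_data_scheme \<Rightarrow> 'm \<Rightarrow> (('m \<Rightarrow> real) \<Rightarrow> real) set" where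
  "tangent_vectors M x =
     {D. (\<forall>f g a b. smooth_fun M f \<longrightarrow> smooth_fun M g \<longrightarrow>
            D (\<lambda>y. a * f y + b * g y) = a * D f + b * D g) \<and>
         (\<forall>f g. smooth_fun M f \<longrightarrow> smooth_fun M g \<longrightarrow>
            D (\<lambda>y. f y * g y) = f x * D g + g x * D f)}"


section \<open>Smooth vector bundles, sections, dual sections and bivectors\<close>

text \<open>
  The fibres are linear subspaces of a common real vector space \<open>'v\<close>. Nothing but the vector space
  structure of the individual fibres is used (in particular different fibres are not compared inside
  \<open>'v\<close>, and \<open>'v\<close> carries no topology); the smooth structure is given by the local trivialisations
  \<open>\<Phi> x : A\<^sub>x \<rightarrow> \<real>\<^sup>r\<close>, with smooth transition matrices.
  As for base manifolds, \<open>\<real>\<^sup>r\<close> is encoded so that \<open>r = 0\<close> is allowed.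
\<close>

definition Rn :: "nat \<Rightarrow> (nat \<Rightarrow> real) set" where
  "Rn r = {c. \<forall>i\<ge>r. c i = 0}"

definition unit_vec :: "nat \<Rightarrow> nat \<Rightarrow> real" where
  "unit_vec j = (\<lambda>i. if i = j then 1 else 0)"

record ('m, 'e, 'v) bundle_data = "('m, 'e) manifold_data" +
  fibre :: "'m \<Rightarrow> 'v set"
  rank :: nat
  trivs :: "('m set \<times> ('m \<Rightarrow> 'v \<Rightarrow> nat \<Rightarrow> real)) set"

definition frame ::
  "('m, 'e, 'v, 'z) bundle_data_scheme \<Rightarrow> ('m \<Rightarrow> 'v \<Rightarrow> nat \<Rightarrow> real) \<Rightarrow> nat \<Rightarrow> 'm \<Rightarrow> 'v" where
  "frame A \<Phi> j x = inv_into (fibre A x) (\<Phi> x) (unit_vec j)"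

definition smooth_vector_bundle ::
  "('m::{t2_space, second_countable_topology}, 'e::euclidean_space, 'v::real_vector, 'z)
     bundle_data_scheme \<Rightarrow> bool"
where
  "smooth_vector_bundle A \<longleftrightarrow>
     smooth_manifold A \<and>
     (\<forall>x. subspace (fibre A x)) \<and>
     (\<Union>(U, \<Phi>)\<in>trivs A. U) = UNIV \<and>
     (\<forall>(U, \<Phi>)\<in>trivs A.
        open U \<and>
        (\<forall>x\<in>U. bij_betw (\<Phi> x) (fibre A x) (Rn (rank A)) \<and>
           (\<forall>v\<in>fibre A x. \<forall>w\<in>fibre A x. \<forall>a b i.
              \<Phi> x (a *\<^sub>R v + b *\<^sub>R w) i = a * \<Phi> x v i + b * \<Phi> x w i))) \<and>
     (\<forall>(U, \<Phi>)\<in>trivs A. \<forall>(V, \<Psi>)\<in>trivs A. \<forall>i<rank A. \<forall>j<rank A.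
        smooth_fun_on A (U \<inter> V) (\<lambda>x. \<Psi> x (frame A \<Phi> j x) i))"

definition smooth_sections ::
  "('m, 'e::euclidean_space, 'v, 'z) bundle_data_scheme \<Rightarrow> ('m \<Rightarrow> 'v) set" where
  "smooth_sections A =
     {X. (\<forall>x. X x \<in> fibre A x) \<and>
         (\<forall>(U, \<Phi>)\<in>trivs A. \<forall>i<rank A. smooth_fun_on A U (\<lambda>x. \<Phi> x (X x) i))}"

text \<open>
  Covectors at \<open>x\<close> are extended by \<open>0\<close> outside the fibre, so that equality of covectors is equality
  on \<open>A\<^sub>x\<close>.
\<close>

definition dual_fibre ::
  "('m, 'e, 'v::real_vector, 'z) bundle_data_scheme \<Rightarrow> 'm \<Rightarrow> ('v \<Rightarrow> real) set" where
  "dual_fibre A x =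
     {\<eta>. (\<forall>v\<in>fibre A x. \<forall>w\<in>fibre A x. \<forall>a b. \<eta> (a *\<^sub>R v + b *\<^sub>R w) = a * \<eta> v + b * \<eta> w) \<and>
         (\<forall>v. v \<notin> fibre A x \<longrightarrow> \<eta> v = 0)}"

definition coframe ::
  "('m, 'e, 'v, 'z) bundle_data_scheme \<Rightarrow> ('m \<Rightarrow> 'v \<Rightarrow> nat \<Rightarrow> real) \<Rightarrow> nat \<Rightarrow> 'm \<Rightarrow> 'v \<Rightarrow> real"
where
  "coframe A \<Phi> i x = (\<lambda>v. if v \<in> fibre A x then \<Phi> x v i else 0)"

definition dual_sections ::
  "('m, 'e::euclidean_space, 'v::real_vector, 'z) bundle_data_scheme \<Rightarrow> ('m \<Rightarrow> 'v \<Rightarrow> real) set"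
where
  "dual_sections A =
     {\<alpha>. (\<forall>x. \<alpha> x \<in> dual_fibre A x) \<and>
         (\<forall>(U, \<Phi>)\<in>trivs A. \<forall>j<rank A. smooth_fun_on A U (\<lambda>x. \<alpha> x (frame A \<Phi> j x)))}"

definition pairing :: "('m \<Rightarrow> 'v \<Rightarrow> real) \<Rightarrow> ('m \<Rightarrow> 'v) \<Rightarrow> 'm \<Rightarrow> real" where
  "pairing \<alpha> X = (\<lambda>x. \<alpha> x (X x))"

text \<open>
  \<open>\<Lambda>\<^sup>2 A\<^sub>x\<close> is the space of alternating bilinear forms on \<open>A\<^sub>x\<^sup>*\<close>.
\<close>

type_synonym ('m, 'v) bivector_field = "'m \<Rightarrow> ('v \<Rightarrow> real) \<Rightarrow> ('v \<Rightarrow> real) \<Rightarrow> real"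

definition bivectors ::
  "('m, 'e::euclidean_space, 'v::real_vector, 'z) bundle_data_scheme \<Rightarrow> ('m, 'v) bivector_field set"
where
  "bivectors A =
     {\<pi>. (\<forall>x. \<forall>\<xi>\<in>dual_fibre A x. \<forall>\<eta>\<in>dual_fibre A x. \<forall>\<zeta>\<in>dual_fibre A x. \<forall>a b.
            \<pi> x (\<lambda>v. a * \<xi> v + b * \<eta> v) \<zeta> = a * \<pi> x \<xi> \<zeta> + b * \<pi> x \<eta> \<zeta> \<and>
            \<pi> x \<zeta> (\<lambda>v. a * \<xi> v + b * \<eta> v) = a * \<pi> x \<zeta> \<xi> + b * \<pi> x \<zeta> \<eta>) \<and>
         (\<forall>x. \<forall>\<xi>\<in>dual_fibre A x. \<pi> x \<xi> \<xi> = 0) \<and>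
         (\<forall>(U, \<Phi>)\<in>trivs A. \<forall>i<rank A. \<forall>j<rank A.
            smooth_fun_on A U (\<lambda>x. \<pi> x (coframe A \<Phi> i x) (coframe A \<Phi> j x)))}"

definition biv_add ::
  "('m, 'v) bivector_field \<Rightarrow> ('m, 'v) bivector_field \<Rightarrow> ('m, 'v) bivector_field" where
  "biv_add \<pi> \<pi>' = (\<lambda>x \<xi> \<eta>. \<pi> x \<xi> \<eta> + \<pi>' x \<xi> \<eta>)"

definition sharp ::
  "('m, 'e, 'v::real_vector, 'z) bundle_data_scheme \<Rightarrow> ('m, 'v) bivector_field \<Rightarrow>
     ('m \<Rightarrow> 'v \<Rightarrow> real) \<Rightarrow> 'm \<Rightarrow> 'v"
where
  "sharp A \<pi> \<xi> = (\<lambda>x. THE v. v \<in> fibre A x \<and> (\<forall>\<eta>\<in>dual_fibre A x. \<eta> v = \<pi> x (\<xi> x) \<eta>))"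


section \<open>Lie algebroids\<close>

record ('m, 'e, 'v) algebroid_data = "('m, 'e, 'v) bundle_data" +
  bracket :: "('m \<Rightarrow> 'v) \<Rightarrow> ('m \<Rightarrow> 'v) \<Rightarrow> 'm \<Rightarrow> 'v"
  anchor :: "'m \<Rightarrow> 'v \<Rightarrow> ('m \<Rightarrow> real) \<Rightarrow> real"

text \<open>
  \<open>anchor_deriv A X f\<close> is \<open>\<rho>(X) f\<close>. Smoothness of the anchor as a bundle map \<open>A \<rightarrow> TM\<close> is the
  statement that \<open>\<rho>(X)\<close> is a smooth vector field for every smooth section \<open>X\<close>.
\<close>

definition anchor_deriv ::
  "('m, 'e, 'v, 'z) algebroid_data_scheme \<Rightarrow> ('m \<Rightarrow> 'v) \<Rightarrow> ('m \<Rightarrow> real) \<Rightarrow> 'm \<Rightarrow> real" where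
  "anchor_deriv A X f = (\<lambda>x. anchor A x (X x) f)"

definition lie_algebroid ::
  "('m::{t2_space, second_countable_topology}, 'e::euclidean_space, 'v::real_vector, 'z)
     algebroid_data_scheme \<Rightarrow> bool"
where
  "lie_algebroid A \<longleftrightarrow>
     smooth_vector_bundle A \<and>
     \<comment> \<open>the anchor is a morphism of vector bundles to the tangent bundle\<close>
     (\<forall>x. \<forall>v\<in>fibre A x. anchor A x v \<in> tangent_vectors A x) \<and>
     (\<forall>x. \<forall>v\<in>fibre A x. \<forall>w\<in>fibre A x. \<forall>a b f. smooth_fun A f \<longrightarrow>
        anchor A x (a *\<^sub>R v + b *\<^sub>R w) f = a * anchor A x v f + b * anchor A x w f) \<and>
     (\<forall>X\<in>smooth_sections A. \<forall>f. smooth_fun A f \<longrightarrow> smooth_fun A (anchor_deriv A X f)) \<and>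
     \<comment> \<open>the bracket is a real Lie algebra structure on the space of sections\<close>
     (\<forall>X\<in>smooth_sections A. \<forall>Y\<in>smooth_sections A. bracket A X Y \<in> smooth_sections A) \<and>
     (\<forall>X\<in>smooth_sections A. \<forall>Y\<in>smooth_sections A. \<forall>Z\<in>smooth_sections A. \<forall>a b.
        bracket A (\<lambda>x. a *\<^sub>R X x + b *\<^sub>R Y x) Z =
          (\<lambda>x. a *\<^sub>R bracket A X Z x + b *\<^sub>R bracket A Y Z x)) \<and>
     (\<forall>X\<in>smooth_sections A. \<forall>Y\<in>smooth_sections A. bracket A X Y = (\<lambda>x. - bracket A Y X x)) \<and>
     (\<forall>X\<in>smooth_sections A. \<forall>Y\<in>smooth_sections A. \<forall>Z\<in>smooth_sections A. \<forall>x.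
        bracket A X (bracket A Y Z) x + bracket A Y (bracket A Z X) x
          + bracket A Z (bracket A X Y) x = 0) \<and>
     \<comment> \<open>Leibniz rule\<close>
     (\<forall>X\<in>smooth_sections A. \<forall>Y\<in>smooth_sections A. \<forall>f. smooth_fun A f \<longrightarrow>
        bracket A X (\<lambda>x. f x *\<^sub>R Y x) =
          (\<lambda>x. f x *\<^sub>R bracket A X Y x + anchor_deriv A X f x *\<^sub>R Y x))"

text \<open>The Lie algebroid differential of a function, as a section of the dual bundle.\<close>

definition differential ::
  "('m, 'e, 'v, 'z) algebroid_data_scheme \<Rightarrow> ('m \<Rightarrow> real) \<Rightarrow> 'm \<Rightarrow> 'v \<Rightarrow> real" where
  "differential A f = (\<lambda>x v. if v \<in> fibre A x then anchor A x v f else 0)"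

definition lie_derivative ::
  "('m, 'e::euclidean_space, 'v::real_vector, 'z) algebroid_data_scheme \<Rightarrow>
     ('m \<Rightarrow> 'v) \<Rightarrow> ('m \<Rightarrow> 'v \<Rightarrow> real) \<Rightarrow> 'm \<Rightarrow> 'v \<Rightarrow> real"
where
  "lie_derivative A X \<alpha> =
     (THE \<beta>. \<beta> \<in> dual_sections A \<and>
        (\<forall>Y\<in>smooth_sections A. \<forall>x.
           pairing \<beta> Y x = anchor_deriv A X (pairing \<alpha> Y) x - pairing \<alpha> (bracket A X Y) x))"

text \<open>The bracket \<open>[\<xi>\<^sub>1, \<xi>\<^sub>2]\<^sub>\<pi>\<close>.\<close>

definition biv_bracket ::
  "('m, 'e::euclidean_space, 'v::real_vector, 'z) algebroid_data_scheme \<Rightarrow>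
     ('m, 'v) bivector_field \<Rightarrow> ('m \<Rightarrow> 'v \<Rightarrow> real) \<Rightarrow> ('m \<Rightarrow> 'v \<Rightarrow> real) \<Rightarrow> 'm \<Rightarrow> 'v \<Rightarrow> real"
where
  "biv_bracket A \<pi> \<xi>1 \<xi>2 =
     (\<lambda>x v. lie_derivative A (sharp A \<pi> \<xi>1) \<xi>2 x v - lie_derivative A (sharp A \<pi> \<xi>2) \<xi>1 x v
        - differential A (\<lambda>y. \<pi> y (\<xi>1 y) (\<xi>2 y)) x v)"

text \<open>
  The Schouten--Nijenhuis bracket of two bivectors, viewed as a map from pairs of dual sections to
  sections. The sign convention is fixed by the formula for the square \<open>[\<pi>, \<pi>]\<close>, namely
  \<open>1/2 [\<pi>, \<pi>](\<xi>\<^sub>1, \<xi>\<^sub>2) = [\<pi>\<xi>\<^sub>1, \<pi>\<xi>\<^sub>2] - \<pi>[\<xi>\<^sub>1, \<xi>\<^sub>2]\<^sub>\<pi>\<close>, and the bracket is its polarization.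
\<close>

definition schouten_square ::
  "('m, 'e::euclidean_space, 'v::real_vector, 'z) algebroid_data_scheme \<Rightarrow>
     ('m, 'v) bivector_field \<Rightarrow> ('m \<Rightarrow> 'v \<Rightarrow> real) \<Rightarrow> ('m \<Rightarrow> 'v \<Rightarrow> real) \<Rightarrow> 'm \<Rightarrow> 'v"
where
  "schouten_square A \<pi> \<xi>1 \<xi>2 =
     (\<lambda>x. 2 *\<^sub>R (bracket A (sharp A \<pi> \<xi>1) (sharp A \<pi> \<xi>2) x - sharp A \<pi> (biv_bracket A \<pi> \<xi>1 \<xi>2) x))"

definition schouten ::
  "('m, 'e::euclidean_space, 'v::real_vector, 'z) algebroid_data_scheme \<Rightarrow>
     ('m, 'v) bivector_field \<Rightarrow> ('m, 'v) bivector_field \<Rightarrow>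
     ('m \<Rightarrow> 'v \<Rightarrow> real) \<Rightarrow> ('m \<Rightarrow> 'v \<Rightarrow> real) \<Rightarrow> 'm \<Rightarrow> 'v"
where
  "schouten A \<pi> \<pi>' \<xi>1 \<xi>2 =
     (\<lambda>x. (1/2) *\<^sub>R (schouten_square A (biv_add \<pi> \<pi>') \<xi>1 \<xi>2 x
                     - schouten_square A \<pi> \<xi>1 \<xi>2 x - schouten_square A \<pi>' \<xi>1 \<xi>2 x))"


section \<open>Relations and their torsion\<close>

definition dual_relation ::
  "('m, 'e::euclidean_space, 'v::real_vector, 'z) algebroid_data_scheme \<Rightarrow>
     (('m \<Rightarrow> 'v) \<times> ('m \<Rightarrow> 'v)) set \<Rightarrow> (('m \<Rightarrow> 'v \<Rightarrow> real) \<times> ('m \<Rightarrow> 'v \<Rightarrow> real)) set"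
where
  "dual_relation A N =
     {(\<beta>, \<alpha>). \<beta> \<in> dual_sections A \<and> \<alpha> \<in> dual_sections A \<and>
        (\<forall>(u, v)\<in>N. pairing \<alpha> u = pairing \<beta> v)}"

text \<open>The torsion is a partial function; outside its domain it is left unspecified.\<close>

definition torsion ::
  "('m, 'e::euclidean_space, 'v::real_vector, 'z) algebroid_data_scheme \<Rightarrow>
     (('m \<Rightarrow> 'v) \<times> ('m \<Rightarrow> 'v)) set \<Rightarrow>
     ('m \<Rightarrow> 'v) \<Rightarrow> ('m \<Rightarrow> 'v) \<Rightarrow> ('m \<Rightarrow> 'v) \<Rightarrow> ('m \<Rightarrow> 'v) \<Rightarrow>
     ('m \<Rightarrow> 'v \<Rightarrow> real) \<Rightarrow> ('m \<Rightarrow> 'v \<Rightarrow> real) \<Rightarrow> ('m \<Rightarrow> 'v \<Rightarrow> real) \<Rightarrow> 'm \<Rightarrow> real"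
where
  "torsion A N u1 v1 u2 v2 \<alpha> \<alpha>' \<alpha>'' =
     (if (u1, v1) \<in> N \<and> (u2, v2) \<in> N \<and>
         (\<alpha>, \<alpha>') \<in> dual_relation A N \<and> (\<alpha>', \<alpha>'') \<in> dual_relation A N
      then (\<lambda>x. pairing \<alpha> (bracket A v1 v2) x
                 - pairing \<alpha>' (\<lambda>y. bracket A v1 u2 y + bracket A u1 v2 y) x
                 + pairing \<alpha>'' (bracket A u1 u2) x)
      else undefined)"

definition bivector_relation ::
  "('m, 'e::euclidean_space, 'v::real_vector, 'z) algebroid_data_scheme \<Rightarrow>
     ('m, 'v) bivector_field \<Rightarrow> ('m, 'v) bivector_field \<Rightarrow> (('m \<Rightarrow> 'v) \<times> ('m \<Rightarrow> 'v)) set"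
where
  "bivector_relation A \<pi> \<pi>' = {(sharp A \<pi>' \<xi>, sharp A \<pi> \<xi>) | \<xi>. \<xi> \<in> dual_sections A}"

definition bivector_torsion ::
  "('m, 'e::euclidean_space, 'v::real_vector, 'z) algebroid_data_scheme \<Rightarrow>
     ('m, 'v) bivector_field \<Rightarrow> ('m, 'v) bivector_field \<Rightarrow>
     ('m \<Rightarrow> 'v \<Rightarrow> real) \<Rightarrow> ('m \<Rightarrow> 'v \<Rightarrow> real) \<Rightarrow>
     ('m \<Rightarrow> 'v \<Rightarrow> real) \<Rightarrow> ('m \<Rightarrow> 'v \<Rightarrow> real) \<Rightarrow> ('m \<Rightarrow> 'v \<Rightarrow> real) \<Rightarrow> 'm \<Rightarrow> real"
where
  "bivector_torsion A \<pi> \<pi>' \<xi>1 \<xi>2 \<xi> \<xi>' \<xi>'' =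
     torsion A (bivector_relation A \<pi> \<pi>')
       (sharp A \<pi>' \<xi>1) (sharp A \<pi> \<xi>1) (sharp A \<pi>' \<xi>2) (sharp A \<pi> \<xi>2) \<xi> \<xi>' \<xi>''"

end

theory Submission
  imports Defs
begin

text \<open>
  Polarizing the defining formula gives
  \<open>[\<pi>, \<pi>'](\<xi>\<^sub>1, \<xi>\<^sub>2) = [\<pi>\<xi>\<^sub>1, \<pi>'\<xi>\<^sub>2] + [\<pi>'\<xi>\<^sub>1, \<pi>\<xi>\<^sub>2] - \<pi>[\<xi>\<^sub>1, \<xi>\<^sub>2]\<^bsub>\<pi>'\<^esub> - \<pi>'[\<xi>\<^sub>1, \<xi>\<^sub>2]\<^bsub>\<pi>\<^esub>\<close>.
  On the right-hand side of the theorem the brackets of sections add up to the torsion, and the terms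
  \<open>\<langle>\<xi>, \<pi>B\<rangle> = - \<langle>B, \<pi>\<xi>\<rangle>\<close> cancel because \<open>\<pi>\<xi> = \<pi>'\<xi>'\<close> and \<open>\<pi>\<xi>' = \<pi>'\<xi>''\<close>. The polarization needs
  \<open>[\<xi>\<^sub>1, \<xi>\<^sub>2]\<^bsub>\<pi>\<^esub>\<close> to be linear in \<open>\<pi>\<close>, hence the definite description of the Lie derivative to denote:
  its existence is tensoriality and its uniqueness the existence of global sections through
  every vector, both obtained from bump functions.
\<close>

section \<open>Calculus of smooth functions on subsets of a linear subspace\<close>

text \<open>The bracket in \<open>lie_algebroid\<close> obeys its axioms on global sections only,
  while frames, and with them coordinates, live over an open set. A local frame must therefore be
  cut off before the bracket can be applied to it. The cutoff functions are asked only to be nonzero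
  near the given point and to vanish off a closed subset of the given open set. No plateau of value
  1 is arranged, since each use cancels the value of the cutoff or divides by it; a flat function
  composed with a squared distance in a single chart then suffices, and partitions of unity do not
  occur. A second point shapes the statements. The map of a bivector acts point by point, so the
  basic lemmas on \<open>sharp\<close> speak of covectors at one point. This lets them apply to
  \<open>biv_bracket\<close>, of which only membership in each dual fibre is established.\<close>

lemma Ck_on_cong:
  assumes "\<And>x. x \<in> S \<Longrightarrow> f x = g x" and "Ck_on k E S f"
  shows "Ck_on k E S g"
proof (cases k)
  case 0
  then show ?thesis
    using assms continuous_on_cong[of S S f g] by simp
next
  case (Suc j)
  with assms(2) obtain D where
    D: "\<forall>x\<in>S. (f has_derivative D x) (at x within S)" "\<forall>v\<in>E. Ck_on j E S (\<lambda>x. D x v)"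
    by auto
  have "\<forall>x\<in>S. (g has_derivative D x) (at x within S)"
    using D(1) assms(1) by (metis has_derivative_transform)
  with D(2) Suc show ?thesis by auto
qed

lemma Ck_on_subset: "Ck_on k E S f \<Longrightarrow> T \<subseteq> S \<Longrightarrow> Ck_on k E T f"
proof (induction k arbitrary: f)
  case 0
  then show ?case by (auto intro: continuous_on_subset)
next
  case (Suc k)
  then obtain D where
    D: "\<forall>x\<in>S. (f has_derivative D x) (at x within S)" "\<forall>v\<in>E. Ck_on k E S (\<lambda>x. D x v)"
    by auto
  have "\<forall>x\<in>T. (f has_derivative D x) (at x within T)"
    using D(1) Suc.prems(2) has_derivative_subset by blast
  moreover have "\<forall>v\<in>E. Ck_on k E T (\<lambda>x. D x v)"
    using D(2) Suc by blast
  ultimately show ?case by auto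
qed

lemma Ck_on_continuous_on: "Ck_on k E S f \<Longrightarrow> continuous_on S f"
proof (cases k)
  case (Suc j)
  assume "Ck_on k E S f"
  with Suc obtain D where "\<And>x. x \<in> S \<Longrightarrow> (f has_derivative D x) (at x within S)" by auto
  then show ?thesis by (rule has_derivative_continuous_on)
qed simp

lemma Ck_on_Suc_imp: "Ck_on (Suc k) E S f \<Longrightarrow> Ck_on k E S f"
proof (induction k arbitrary: f)
  case 0
  then show ?case by (metis Ck_on.simps(1) Ck_on_continuous_on)
next
  case (Suc k)
  then obtain D where
    D: "\<forall>x\<in>S. (f has_derivative D x) (at x within S)" "\<forall>v\<in>E. Ck_on (Suc k) E S (\<lambda>x. D x v)"
    by (metis Ck_on.simps(2))
  then have "\<forall>v\<in>E. Ck_on k E S (\<lambda>x. D x v)" using Suc.IH by blast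
  with D(1) show ?case by auto
qed

lemma Ck_on_const: "Ck_on k E S (\<lambda>x. c)"
proof (induction k arbitrary: c)
  case (Suc k)
  then show ?case by (auto intro!: exI[of _ "\<lambda>x v. 0"])
qed simp

lemma Ck_on_add: "Ck_on k E S f \<Longrightarrow> Ck_on k E S g \<Longrightarrow> Ck_on k E S (\<lambda>x. f x + g x)"
proof (induction k arbitrary: f g)
  case 0
  then show ?case by (auto intro: continuous_intros)
next
  case (Suc k)
  then obtain Df Dg where
    D: "\<forall>x\<in>S. (f has_derivative Df x) (at x within S)" "\<forall>v\<in>E. Ck_on k E S (\<lambda>x. Df x v)"
       "\<forall>x\<in>S. (g has_derivative Dg x) (at x within S)" "\<forall>v\<in>E. Ck_on k E S (\<lambda>x. Dg x v)"
    by auto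
  have "\<forall>x\<in>S. ((\<lambda>x. f x + g x) has_derivative (\<lambda>v. Df x v + Dg x v)) (at x within S)"
    using D by (auto intro: has_derivative_add)
  moreover have "\<forall>v\<in>E. Ck_on k E S (\<lambda>x. Df x v + Dg x v)"
    using D Suc.IH by blast
  ultimately show ?case
    unfolding Ck_on.simps by (intro exI[of _ "\<lambda>x v. Df x v + Dg x v"] conjI)
qed

text \<open>The Leibniz rule returns \<open>B\<close> applied to one of \<open>f\<close>,
  \<open>g\<close> and a derivative of the other, so the induction stays inside the class once
  \<open>f\<close> and \<open>g\<close> themselves are lowered to order \<open>k\<close>. A general
  \<open>B\<close> serves the product of reals and the inner product alike.\<close>

lemma Ck_on_bilinear:
  assumes "bounded_bilinear B"
  shows "Ck_on k E S f \<Longrightarrow> Ck_on k E S g \<Longrightarrow> Ck_on k E S (\<lambda>x. B (f x) (g x))"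
proof (induction k arbitrary: f g)
  case 0
  then show ?case using bounded_bilinear.continuous_on[OF assms, of S f g] by simp
next
  case (Suc k)
  then obtain Df Dg where
    D: "\<forall>x\<in>S. (f has_derivative Df x) (at x within S)" "\<forall>v\<in>E. Ck_on k E S (\<lambda>x. Df x v)"
       "\<forall>x\<in>S. (g has_derivative Dg x) (at x within S)" "\<forall>v\<in>E. Ck_on k E S (\<lambda>x. Dg x v)"
    by auto
  have fg: "Ck_on k E S f" "Ck_on k E S g"
    using Suc.prems Ck_on_Suc_imp by blast+
  have "\<forall>x\<in>S. ((\<lambda>x. B (f x) (g x)) has_derivative (\<lambda>v. B (f x) (Dg x v) + B (Df x v) (g x))) (at x within S)"
    using D by (intro ballI bounded_bilinear.FDERIV[OF assms]) auto
  moreover have "\<forall>v\<in>E. Ck_on k E S (\<lambda>x. B (f x) (Dg x v) + B (Df x v) (g x))"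
  proof
    fix v assume "v \<in> E"
    with D have "Ck_on k E S (\<lambda>x. Dg x v)" "Ck_on k E S (\<lambda>x. Df x v)" by auto
    from Ck_on_add[OF Suc.IH[OF fg(1) this(1)] Suc.IH[OF this(2) fg(2)]]
    show "Ck_on k E S (\<lambda>x. B (f x) (Dg x v) + B (Df x v) (g x))" .
  qed
  ultimately show ?case
    unfolding Ck_on.simps by (intro exI[of _ "\<lambda>x v. B (f x) (Dg x v) + B (Df x v) (g x)"] conjI)
qed

lemmas Ck_on_mult = Ck_on_bilinear[OF bounded_bilinear_mult]
lemmas Ck_on_inner = Ck_on_bilinear[OF bounded_bilinear_inner]

text \<open>The derivative is a product of \<open>D x v\<close> with two copies of
  \<open>inverse (f x)\<close>, and that function is already of order \<open>k\<close> by the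
  induction hypothesis.\<close>

lemma Ck_on_inverse:
  fixes f :: "'e::real_normed_vector \<Rightarrow> real"
  shows "Ck_on k E S f \<Longrightarrow> \<forall>x\<in>S. f x \<noteq> 0 \<Longrightarrow> Ck_on k E S (\<lambda>x. inverse (f x))"
proof (induction k arbitrary: f)
  case 0
  then show ?case by (auto intro: continuous_intros)
next
  case (Suc k)
  then obtain D where
    D: "\<forall>x\<in>S. (f has_derivative D x) (at x within S)" "\<forall>v\<in>E. Ck_on k E S (\<lambda>x. D x v)"
    by auto
  have i: "Ck_on k E S (\<lambda>x. inverse (f x))"
    using Suc Ck_on_Suc_imp by blast
  have "\<forall>x\<in>S. ((\<lambda>x. inverse (f x)) has_derivative (\<lambda>v. - 1 * (inverse (f x) * D x v * inverse (f x)))) (at x within S)"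
    using D Suc.prems(2) by (auto intro!: derivative_eq_intros)
  moreover have "\<forall>v\<in>E. Ck_on k E S (\<lambda>x. - 1 * (inverse (f x) * D x v * inverse (f x)))"
    using D i by (intro ballI Ck_on_mult Ck_on_const) auto
  ultimately show ?case
    unfolding Ck_on.simps
    by (intro exI[of _ "\<lambda>x v. - 1 * (inverse (f x) * D x v * inverse (f x))"] conjI)
qed

text \<open>For \<open>v\<close> in \<open>E\<close>, relative openness keeps the points
  \<open>x + t *\<^sub>R v\<close> in \<open>S\<close> for all small \<open>t\<close>. Restricting
  \<open>f\<close> to this line gives an ordinary derivative at 0 of a function of one real
  variable, and that is unique.\<close>

lemma has_derivative_within_openin_unique:
  assumes "(f has_derivative D) (at x within S)" "(f has_derivative D') (at x within S)"
    and E: "subspace E" "openin (top_of_set E) S" and "x \<in> S" "v \<in> E"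
  shows "D v = D' v"
proof -
  define T where "T = {t::real. x + t *\<^sub>R v \<in> S}"
  obtain W where W: "open W" "S = E \<inter> W" using E(2) by (auto simp: openin_open)
  have "T = (\<lambda>t. x + t *\<^sub>R v) -` W"
    using E(1) assms(5,6) W by (auto simp: T_def intro: subspace_add subspace_scale)
  moreover have "open ((\<lambda>t::real. x + t *\<^sub>R v) -` W)"
    by (intro open_vimage W continuous_intros)
  ultimately have "open T" by simp
  moreover have "0 \<in> T" using \<open>x \<in> S\<close> by (simp add: T_def)
  ultimately have T: "open T" "0 \<in> T" .
  have im: "(\<lambda>t. x + t *\<^sub>R v) ` T \<subseteq> S" by (auto simp: T_def)
  have line: "((\<lambda>t. x + t *\<^sub>R v) has_derivative (\<lambda>t. t *\<^sub>R v)) (at 0 within T)"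
    by (auto intro!: derivative_eq_intros)
  have "((\<lambda>t. f (x + t *\<^sub>R v)) has_derivative (\<lambda>t. B (t *\<^sub>R v))) (at 0)"
    if "(f has_derivative B) (at x within S)" for B
    using has_derivative_in_compose[OF line, of f B] has_derivative_subset[OF that im]
      at_within_open[OF T(2,1)] by simp
  then have "(\<lambda>t. D (t *\<^sub>R v)) = (\<lambda>t. D' (t *\<^sub>R v))"
    using assms(1,2) has_derivative_unique by blast
  then show ?thesis by (metis scaleR_one)
qed

lemma at_within_openin:
  assumes "openin (top_of_set S) T" "x \<in> T"
  shows "at x within T = at x within S"
proof -
  obtain W where "open W" "T = S \<inter> W" using assms(1) by (auto simp: openin_open)
  with assms(2) show ?thesis by (intro at_within_nhd[of x W]) auto
qed

text \<open>\<open>Ck_on\<close> wants one \<open>D\<close> on all of \<open>S\<close>, while the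
  hypothesis supplies one for each neighbourhood. The diagonal \<open>D x x\<close> glues them: by
  uniqueness it agrees on each \<open>T x\<close> with the local derivative in the directions of
  \<open>E\<close>. The induction generalises \<open>f\<close> because it is applied to this glued
  directional derivative.\<close>

lemma Ck_on_local:
  assumes E: "subspace E" and S: "openin (top_of_set E) S"
    and "\<And>x. x \<in> S \<Longrightarrow> \<exists>T. openin (top_of_set E) T \<and> x \<in> T \<and> T \<subseteq> S \<and> Ck_on k E T f"
  shows "Ck_on k E S f"
  using assms(3)
proof (induction k arbitrary: f)
  case 0
  then obtain T where T: "\<And>x. x \<in> S \<Longrightarrow> openin (top_of_set E) (T x)"
    "\<And>x. x \<in> S \<Longrightarrow> x \<in> T x" "\<And>x. x \<in> S \<Longrightarrow> T x \<subseteq> S" "\<And>x. x \<in> S \<Longrightarrow> Ck_on 0 E (T x) f"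
    by metis
  have "continuous (at x within S) f" if "x \<in> S" for x
    using T that S at_within_openin[of S "T x" x] openin_subset_trans[of E "T x" S]
    by (metis Ck_on.simps(1) continuous_on_eq_continuous_within openin_imp_subset)
  then show ?case by (simp add: continuous_on_eq_continuous_within)
next
  case (Suc k)
  obtain T where T: "\<And>x. x \<in> S \<Longrightarrow> openin (top_of_set E) (T x)"
    "\<And>x. x \<in> S \<Longrightarrow> x \<in> T x" "\<And>x. x \<in> S \<Longrightarrow> T x \<subseteq> S" "\<And>x. x \<in> S \<Longrightarrow> Ck_on (Suc k) E (T x) f"
    using Suc.prems by metis
  then have "\<forall>x\<in>S. \<exists>D. (\<forall>y\<in>T x. (f has_derivative D y) (at y within T x)) \<and>
      (\<forall>v\<in>E. Ck_on k E (T x) (\<lambda>y. D y v))"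
    by auto
  then obtain D where
    D: "\<And>x y. x \<in> S \<Longrightarrow> y \<in> T x \<Longrightarrow> (f has_derivative D x y) (at y within T x)"
       "\<And>x v. x \<in> S \<Longrightarrow> v \<in> E \<Longrightarrow> Ck_on k E (T x) (\<lambda>y. D x y v)"
    by metis
  have wi: "at y within T x = at y within S" if "x \<in> S" "y \<in> T x" for x y
    using T S that by (meson at_within_openin openin_imp_subset openin_subset_trans)
  have d: "(f has_derivative D x y) (at y within S)" if "x \<in> S" "y \<in> T x" for x y
    using D(1)[OF that] wi[OF that] by simp
  have "Ck_on k E S (\<lambda>x. D x x v)" if v: "v \<in> E" for v
  proof (rule Suc.IH)
    fix x assume x: "x \<in> S"
    have "D x y v = D y y v" if "y \<in> T x" for y
      using has_derivative_within_openin_unique[OF d[OF x that] d[of y y] E S _ v] T x that by blast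
    then have "Ck_on k E (T x) (\<lambda>x. D x x v)"
      using Ck_on_cong[OF _ D(2)[OF x v]] by simp
    then show "\<exists>T. openin (top_of_set E) T \<and> x \<in> T \<and> T \<subseteq> S \<and> Ck_on k E T (\<lambda>x. D x x v)"
      using T x by blast
  qed
  moreover have "\<forall>x\<in>S. (f has_derivative D x x) (at x within S)"
    using d T by blast
  ultimately show ?case
    unfolding Ck_on.simps by (intro exI[of _ "\<lambda>x. D x x"]) auto
qed

text \<open>
  The family is closed under differentiation up to linear combinations, which yields smoothness of
  the flat function \<open>flat 0\<close> by a single induction over all members.
\<close>

definition flat :: "nat \<Rightarrow> real \<Rightarrow> real" where
  "flat n t = (if 0 < t then exp (- (1 / t)) / t ^ n else 0)"

lemma flat_pos_iff: "0 < flat n t \<longleftrightarrow> 0 < t"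
  by (auto simp: flat_def)

lemma DERIV_flat: "(flat n has_real_derivative flat (n + 2) t - n * flat (n + 1) t) (at t)"
proof -
  consider "t > 0" | "t < 0" | "t = 0" by linarith
  then show ?thesis
  proof cases
    case 1
    have "((\<lambda>t. exp (- (1 / t)) / t ^ n) has_real_derivative flat (n + 2) t - n * flat (n + 1) t) (at t)"
      using 1 by (auto intro!: derivative_eq_intros simp: flat_def)
        (cases n; simp add: field_simps power2_eq_square)
    then show ?thesis
      by (rule has_field_derivative_transform_within_open[of _ _ _ "{0<..}"])
        (use 1 in \<open>auto simp: flat_def\<close>)
  next
    case 2
    have "((\<lambda>t. 0) has_real_derivative flat (n + 2) t - n * flat (n + 1) t) (at t)"
      using 2 by (simp add: flat_def)
    then show ?thesis
      by (rule has_field_derivative_transform_within_open[of _ _ _ "{..<0}"])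
        (use 2 in \<open>auto simp: flat_def\<close>)
  next
    case 3
    \<comment> \<open>At 0 the difference quotient is \<open>flat n t / t\<close>. It is 0 on the
      left; on the right the substitution \<open>s = 1 / t\<close> turns it into
      \<open>s ^ Suc n / exp s\<close> with \<open>s\<close> tending to infinity.\<close>
    have "((\<lambda>t::real. exp (- (1 / t)) / t ^ Suc n) \<longlongrightarrow> 0) (at_right 0)"
    proof -
      have eq: "exp (- (1 / t)) / t ^ Suc n = inverse t ^ Suc n / exp (inverse t)" for t :: real
        by (simp only: exp_minus divide_inverse power_inverse mult_1 mult.commute)
      show ?thesis
        unfolding eq
        by (rule filterlim_compose[OF tendsto_power_div_exp_0 filterlim_inverse_at_top_right])
    qed
    moreover have "eventually (\<lambda>t. exp (- (1 / t)) / t ^ Suc n = flat n t / t) (at_right 0)"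
      by (auto simp: eventually_at_filter flat_def)
    ultimately have "((\<lambda>t. flat n t / t) \<longlongrightarrow> 0) (at_right 0)"
      by (rule Lim_transform_eventually)
    moreover have "((\<lambda>t. flat n t / t) \<longlongrightarrow> 0) (at_left 0)"
      by (rule Lim_transform_eventually[OF tendsto_const])
        (auto simp: eventually_at_filter flat_def)
    ultimately have "((\<lambda>t. flat n t / t) \<longlongrightarrow> 0) (at 0)"
      by (simp add: filterlim_split_at)
    then show ?thesis
      using 3 by (simp add: DERIV_def flat_def)
  qed
qed

lemma Ck_on_flat: "Ck_on k E S f \<Longrightarrow> Ck_on k E S (\<lambda>x. flat n (f x))"
proof (induction k arbitrary: n)
  case 0
  have "continuous_on UNIV (flat n)"
    using DERIV_flat DERIV_isCont by (blast intro: continuous_at_imp_continuous_on)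
  with 0 show ?case by (auto intro: continuous_on_compose2)
next
  case (Suc k)
  then obtain D where
    D: "\<forall>x\<in>S. (f has_derivative D x) (at x within S)" "\<forall>v\<in>E. Ck_on k E S (\<lambda>x. D x v)"
    by auto
  let ?D = "\<lambda>x v. (flat (n + 2) (f x) + (- real n) * flat (n + 1) (f x)) * D x v"
  have "((\<lambda>x. flat n (f x)) has_derivative ?D x) (at x within S)" if "x \<in> S" for x
    using has_derivative_compose[of f "D x" x S "flat n"] D(1) that DERIV_flat[of n "f x"]
    unfolding has_field_derivative_def by auto
  moreover have "Ck_on k E S (\<lambda>x. ?D x v)" if "v \<in> E" for v
    using D(2) Suc Ck_on_Suc_imp that by (intro Ck_on_mult Ck_on_add Ck_on_const) blast+
  ultimately show ?case
    unfolding Ck_on.simps by (intro exI[of _ ?D]) auto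
qed

section \<open>Smooth functions on manifolds\<close>

lemma smooth_fun_on_Ck:
  "smooth_fun_on M W f \<longleftrightarrow>
    (\<forall>(U, \<phi>)\<in>atlas M. \<forall>k. Ck_on k (model M) (\<phi> ` (U \<inter> W)) (\<lambda>y. f (inv_into U \<phi> y)))"
  by (simp add: smooth_fun_on_def Cinf_on_def comp_def)

lemma smooth_fun_on_subset: "smooth_fun_on M W f \<Longrightarrow> V \<subseteq> W \<Longrightarrow> smooth_fun_on M V f"
  unfolding smooth_fun_on_Ck by (fastforce elim: Ck_on_subset)

lemma smooth_fun_imp_on: "smooth_fun M f \<Longrightarrow> smooth_fun_on M W f"
  by (erule smooth_fun_on_subset) simp

lemma smooth_fun_on_const: "smooth_fun_on M W (\<lambda>x. c)"
  by (auto simp: smooth_fun_on_Ck intro: Ck_on_const)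

lemma smooth_fun_on_add:
  "smooth_fun_on M W f \<Longrightarrow> smooth_fun_on M W g \<Longrightarrow> smooth_fun_on M W (\<lambda>x. f x + g x)"
  unfolding smooth_fun_on_Ck by (fastforce intro: Ck_on_add)

lemma smooth_fun_on_mult:
  "smooth_fun_on M W f \<Longrightarrow> smooth_fun_on M W g \<Longrightarrow> smooth_fun_on M W (\<lambda>x. f x * g x)"
  unfolding smooth_fun_on_Ck by (fastforce intro: Ck_on_mult)

lemma smooth_fun_on_flat: "smooth_fun_on M W f \<Longrightarrow> smooth_fun_on M W (\<lambda>x. flat n (f x))"
  unfolding smooth_fun_on_Ck by (fastforce intro: Ck_on_flat)

lemma smooth_fun_on_sum:
  "(\<And>i. i \<in> I \<Longrightarrow> smooth_fun_on M W (f i)) \<Longrightarrow> smooth_fun_on M W (\<lambda>x. \<Sum>i\<in>I. f i x)"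
  by (induction I rule: infinite_finite_induct)
    (auto intro: smooth_fun_on_const smooth_fun_on_add)

section \<open>Charts, locality and bump functions\<close>

lemma smooth_manifoldD:
  assumes "smooth_manifold M"
  shows "subspace (model M)" and "\<exists>(U, \<phi>)\<in>atlas M. x \<in> U"
    and "(U, \<phi>) \<in> atlas M \<Longrightarrow> open U"
    and "(U, \<phi>) \<in> atlas M \<Longrightarrow> openin (top_of_set (model M)) (\<phi> ` U)"
    and "(U, \<phi>) \<in> atlas M \<Longrightarrow> homeomorphism U (\<phi> ` U) \<phi> (inv_into U \<phi>)"
    and "(U, \<phi>) \<in> atlas M \<Longrightarrow> (V, \<psi>) \<in> atlas M \<Longrightarrow>
           Cinf_on (model M) (\<phi> ` (U \<inter> V)) (\<psi> \<circ> inv_into U \<phi>)"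
  using assms unfolding smooth_manifold_def by fastforce+

lemma smooth_manifold_inv_into:
  assumes "smooth_manifold M" "(U, \<phi>) \<in> atlas M" "x \<in> U"
  shows "inv_into U \<phi> (\<phi> x) = x"
  using smooth_manifoldD(5)[OF assms(1,2)] assms(3) by (simp add: homeomorphism_apply1)

lemma openin_chart_image:
  assumes M: "smooth_manifold M" and U: "(U, \<phi>) \<in> atlas M" and "open W"
  shows "openin (top_of_set (model M)) (\<phi> ` (U \<inter> W))"
proof -
  have "openin (top_of_set U) (U \<inter> W)" using assms(3) by auto
  then have "openin (top_of_set (\<phi> ` U)) (\<phi> ` (U \<inter> W))"
    using homeomorphism_imp_open_map smooth_manifoldD(5)[OF M U] by blast
  then show ?thesis using smooth_manifoldD(4)[OF M U] openin_trans by blast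
qed

lemma smooth_fun_on_cong:
  assumes M: "smooth_manifold M" and "\<And>x. x \<in> W \<Longrightarrow> f x = g x" and "smooth_fun_on M W f"
  shows "smooth_fun_on M W g"
  unfolding smooth_fun_on_Ck
proof (clarify)
  fix U \<phi> k assume U: "(U, \<phi>) \<in> atlas M"
  have "Ck_on k (model M) (\<phi> ` (U \<inter> W)) (\<lambda>y. f (inv_into U \<phi> y))"
    using assms(3) U by (auto simp: smooth_fun_on_Ck)
  then show "Ck_on k (model M) (\<phi> ` (U \<inter> W)) (\<lambda>y. g (inv_into U \<phi> y))"
    by (rule Ck_on_cong[rotated]) (use assms(2) smooth_manifold_inv_into[OF M U] in auto)
qed

lemma smooth_fun_on_inverse:
  assumes M: "smooth_manifold M" and "smooth_fun_on M W f" and "\<And>x. x \<in> W \<Longrightarrow> f x \<noteq> 0"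
  shows "smooth_fun_on M W (\<lambda>x. inverse (f x))"
  unfolding smooth_fun_on_Ck
proof (clarify)
  fix U \<phi> k assume U: "(U, \<phi>) \<in> atlas M"
  show "Ck_on k (model M) (\<phi> ` (U \<inter> W)) (\<lambda>y. inverse (f (inv_into U \<phi> y)))"
    using assms(2,3) U smooth_manifold_inv_into[OF M U]
    by (intro Ck_on_inverse) (auto simp: smooth_fun_on_Ck)
qed

text \<open>Charts carry open sets to relatively open ones, so neighbourhoods in \<open>W\<close>
  become neighbourhoods in each chart image and \<open>Ck_on_local\<close> applies there.\<close>

lemma smooth_fun_on_local:
  assumes M: "smooth_manifold M" and W: "open W"
    and loc: "\<And>x. x \<in> W \<Longrightarrow> \<exists>N. open N \<and> x \<in> N \<and> smooth_fun_on M (W \<inter> N) f"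
  shows "smooth_fun_on M W f"
  unfolding smooth_fun_on_Ck
proof (clarify)
  fix U \<phi> k assume U: "(U, \<phi>) \<in> atlas M"
  show "Ck_on k (model M) (\<phi> ` (U \<inter> W)) (\<lambda>y. f (inv_into U \<phi> y))"
  proof (rule Ck_on_local)
    show "subspace (model M)" using smooth_manifoldD(1)[OF M] .
    show "openin (top_of_set (model M)) (\<phi> ` (U \<inter> W))" using openin_chart_image[OF M U W] .
    fix y assume "y \<in> \<phi> ` (U \<inter> W)"
    then obtain x where x: "x \<in> U" "x \<in> W" "y = \<phi> x" by auto
    then obtain N where N: "open N" "x \<in> N" "smooth_fun_on M (W \<inter> N) f" using loc by auto
    have "Ck_on k (model M) (\<phi> ` (U \<inter> (W \<inter> N))) (\<lambda>y. f (inv_into U \<phi> y))"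
      using N(3) U by (auto simp: smooth_fun_on_Ck)
    moreover have "openin (top_of_set (model M)) (\<phi> ` (U \<inter> (W \<inter> N)))"
      using openin_chart_image[OF M U] W N(1) by blast
    ultimately show "\<exists>T. openin (top_of_set (model M)) T \<and> y \<in> T \<and> T \<subseteq> \<phi> ` (U \<inter> W) \<and>
        Ck_on k (model M) T (\<lambda>y. f (inv_into U \<phi> y))"
      using x N(2) by (intro exI[of _ "\<phi> ` (U \<inter> (W \<inter> N))"]) auto
  qed
qed

text \<open>Extension by zero: \<open>U\<close> and \<open>- K\<close> cover the manifold, and on
  the second set the product vanishes. The function \<open>g\<close> may be arbitrary outside
  \<open>U\<close>, as the components of a local frame are.\<close>

lemma smooth_fun_on_mult_support:
  assumes M: "smooth_manifold M" and W: "open W" and K: "closed K" "K \<subseteq> U" "open U"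
    and \<rho>: "smooth_fun_on M (U \<inter> W) \<rho>" "\<And>x. x \<notin> K \<Longrightarrow> \<rho> x = 0"
    and g: "smooth_fun_on M (U \<inter> W) g"
  shows "smooth_fun_on M W (\<lambda>x. \<rho> x * g x)"
proof (rule smooth_fun_on_local[OF M W])
  fix x assume "x \<in> W"
  show "\<exists>N. open N \<and> x \<in> N \<and> smooth_fun_on M (W \<inter> N) (\<lambda>x. \<rho> x * g x)"
  proof (cases "x \<in> U")
    case True
    have "smooth_fun_on M (W \<inter> U) (\<lambda>x. \<rho> x * g x)"
      using smooth_fun_on_mult[OF \<rho>(1) g] by (simp add: Int_commute)
    with True K(3) show ?thesis by blast
  next
    case False
    have "smooth_fun_on M (W \<inter> - K) (\<lambda>x. \<rho> x * g x)"
      by (rule smooth_fun_on_cong[OF M _ smooth_fun_on_const[of M _ 0]]) (use \<rho> in auto)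
    with False K show ?thesis by (intro exI[of _ "- K"]) auto
  qed
qed

text \<open>In a chart \<phi> around \<open>p\<close>, the function is \<open>flat 0\<close> of
  \<open>r^2\<close> minus the squared distance to \<open>\<phi> p\<close>, hence positive exactly
  over the open ball. \<open>K\<close> comes from the closed ball in the model space: it is compact,
  so it is closed in the whole Hausdorff manifold and not merely in the chart domain. This is what
  permits extension by zero.\<close>

lemma smooth_bump:
  assumes M: "smooth_manifold M" and U: "open U" "p \<in> U"
  obtains \<rho> K N where "smooth_fun M \<rho>" "closed K" "K \<subseteq> U" "\<And>x. x \<notin> K \<Longrightarrow> \<rho> x = 0"
    "open N" "p \<in> N" "\<And>x. x \<in> N \<Longrightarrow> \<rho> x \<noteq> 0"
proof -
  obtain V \<phi> where V: "(V, \<phi>) \<in> atlas M" "p \<in> V" using smooth_manifoldD(2)[OF M, of p] by auto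
  note hom = smooth_manifoldD(5)[OF M V(1)]
  note inv = smooth_manifold_inv_into[OF M V(1)]
  let ?E = "model M"
  have Vo: "open V" using smooth_manifoldD(3)[OF M V(1)] .
  obtain r where r: "r > 0" "cball (\<phi> p) r \<inter> ?E \<subseteq> \<phi> ` (V \<inter> U)"
    using openin_chart_image[OF M V(1) U(1)] V(2) U(2) unfolding openin_contains_cball by blast
  define K where "K = inv_into V \<phi> ` (cball (\<phi> p) r \<inter> ?E)"
  define N where "N = {x \<in> V. \<phi> x \<in> ball (\<phi> p) r}"
  define q where "q x = r\<^sup>2 - (\<phi> x - \<phi> p) \<bullet> (\<phi> x - \<phi> p)" for x
  define \<rho> where "\<rho> x = (if x \<in> V then flat 0 (q x) else 0)" for x
  have qpos: "q x > 0 \<longleftrightarrow> \<phi> x \<in> ball (\<phi> p) r" for x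
    using r(1) abs_le_square_iff[of r "norm (\<phi> x - \<phi> p)"]
    by (simp add: q_def dist_norm norm_minus_commute dot_square_norm not_less flip: not_le)
  have "compact (cball (\<phi> p) r \<inter> ?E)"
    using smooth_manifoldD(1)[OF M] closed_subspace by (intro compact_Int_closed) auto
  moreover have "continuous_on (cball (\<phi> p) r \<inter> ?E) (inv_into V \<phi>)"
    using homeomorphism_cont2[OF hom] r(2) by (auto intro: continuous_on_subset)
  ultimately have K: "closed K" unfolding K_def
    by (intro compact_imp_closed compact_continuous_image)
  have KVU: "K \<subseteq> V \<inter> U"
    using r(2) inv by (auto simp: K_def)
  have VE: "\<phi> ` V \<subseteq> ?E"
    using smooth_manifoldD(4)[OF M V(1)] openin_imp_subset by blast
  have \<rho>0: "\<rho> x = 0" if "x \<notin> K" for x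
  proof (rule ccontr)
    assume a: "\<rho> x \<noteq> 0"
    then have x: "x \<in> V" "q x > 0" by (auto simp: \<rho>_def flat_def split: if_splits)
    then have "\<phi> x \<in> cball (\<phi> p) r \<inter> ?E" using qpos VE by auto
    then have "x \<in> K" using inv[OF x(1)] unfolding K_def by (metis imageI)
    with that show False by simp
  qed
  have N: "open N"
  proof -
    have "openin (top_of_set V) (V \<inter> \<phi> -` ball (\<phi> p) r)"
      using homeomorphism_cont1[OF hom] by (auto intro: continuous_openin_preimage_gen)
    then have "open (V \<inter> \<phi> -` ball (\<phi> p) r)" using Vo openin_open_trans by blast
    moreover have "N = V \<inter> \<phi> -` ball (\<phi> p) r" by (auto simp: N_def)
    ultimately show ?thesis by simp
  qed
  have "smooth_fun_on M V q"
    unfolding smooth_fun_on_Ck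
  proof clarify
    fix W \<psi> k assume W: "(W, \<psi>) \<in> atlas M"
    have "Ck_on k ?E (\<psi> ` (W \<inter> V)) (\<lambda>y. \<phi> (inv_into W \<psi> y))"
      using smooth_manifoldD(6)[OF M W V(1)] by (simp add: Cinf_on_def comp_def)
    then have "Ck_on k ?E (\<psi> ` (W \<inter> V)) (\<lambda>y. \<phi> (inv_into W \<psi> y) + (- \<phi> p))"
      by (intro Ck_on_add Ck_on_const)
    then have "Ck_on k ?E (\<psi> ` (W \<inter> V)) (\<lambda>y. r\<^sup>2 + (- 1) *
        ((\<phi> (inv_into W \<psi> y) + (- \<phi> p)) \<bullet> (\<phi> (inv_into W \<psi> y) + (- \<phi> p))))"
      by (intro Ck_on_add[of _ _ _ "\<lambda>x. r\<^sup>2"] Ck_on_const Ck_on_mult Ck_on_inner)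
    then show "Ck_on k ?E (\<psi> ` (W \<inter> V)) (\<lambda>y. q (inv_into W \<psi> y))"
      by (simp add: q_def)
  qed
  then have "smooth_fun_on M V (\<lambda>x. flat 0 (q x))" by (rule smooth_fun_on_flat)
  then have "smooth_fun_on M V \<rho>"
    by (rule smooth_fun_on_cong[OF M, rotated]) (simp add: \<rho>_def)
  \<comment> \<open>The constant 1 takes the role of \<open>g\<close>, so that extension by zero
    applies to \<rho> alone.\<close>
  then have "smooth_fun M (\<lambda>x. \<rho> x * 1)"
    using KVU K Vo \<rho>0 by (intro smooth_fun_on_mult_support[OF M, of _ K V])
      (auto intro: smooth_fun_on_const)
  then have "smooth_fun M \<rho>" by simp
  moreover have "p \<in> N" using V r by (simp add: N_def)
  moreover have "\<rho> x \<noteq> 0" if "x \<in> N" for x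
    using that qpos[of x] flat_pos_iff[of 0 "q x"] by (auto simp: N_def \<rho>_def)
  ultimately show ?thesis using that K KVU \<rho>0 N by (metis le_inf_iff)
qed

section \<open>Vector bundles\<close>

text \<open>Linearity is asked for on \<open>S\<close> only, because \<open>g\<close> will be a
  covector or a coordinate of a trivialisation, both of which are known to be linear just on a
  fibre.\<close>

lemma linear_combination_sum:
  fixes g :: "'v::real_vector \<Rightarrow> real"
  assumes S: "subspace S"
    and g: "\<And>v w a b. v \<in> S \<Longrightarrow> w \<in> S \<Longrightarrow> g (a *\<^sub>R v + b *\<^sub>R w) = a * g v + b * g w"
    and w: "\<And>j. j \<in> J \<Longrightarrow> w j \<in> S"
  shows "g (\<Sum>j\<in>J. c j *\<^sub>R w j) = (\<Sum>j\<in>J. c j * g (w j))"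
proof -
  have g0: "g 0 = 0" using g[of 0 0 0 0] subspace_0[OF S] by simp
  show ?thesis using w
  proof (induction J rule: infinite_finite_induct)
    case (insert k J)
    then have "(\<Sum>j\<in>J. c j *\<^sub>R w j) \<in> S"
      by (intro subspace_sum[OF S] subspace_scale[OF S]) auto
    with insert g[of "w k" "\<Sum>j\<in>J. c j *\<^sub>R w j" "c k" 1] show ?case by simp
  qed (auto simp: g0)
qed

section \<open>Covectors and bivectors at a point\<close>

lemma dual_fibre_0: "(\<lambda>v. 0) \<in> dual_fibre A x"
  by (simp add: dual_fibre_def)

lemma dual_fibre_lin:
  "\<xi> \<in> dual_fibre A x \<Longrightarrow> \<eta> \<in> dual_fibre A x \<Longrightarrow> (\<lambda>v. a * \<xi> v + b * \<eta> v) \<in> dual_fibre A x"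
  by (auto simp: dual_fibre_def algebra_simps)

lemma dual_fibre_sum:
  "(\<And>j. j \<in> J \<Longrightarrow> \<xi> j \<in> dual_fibre A x) \<Longrightarrow> (\<lambda>v. \<Sum>j\<in>J. c j * \<xi> j v) \<in> dual_fibre A x"
proof (induction J rule: infinite_finite_induct)
  case (insert k J)
  then show ?case using dual_fibre_lin[of "\<xi> k" A x "\<lambda>v. \<Sum>j\<in>J. c j * \<xi> j v" "c k" 1] by simp
qed (auto simp: dual_fibre_0)

lemma dual_fibre_combination:
  "\<eta> \<in> dual_fibre A x \<Longrightarrow> v \<in> fibre A x \<Longrightarrow> w \<in> fibre A x \<Longrightarrow>
     \<eta> (a *\<^sub>R v + b *\<^sub>R w) = a * \<eta> v + b * \<eta> w"
  by (auto simp: dual_fibre_def)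

lemma dual_sections_fibre: "\<alpha> \<in> dual_sections A \<Longrightarrow> \<alpha> x \<in> dual_fibre A x"
  by (auto simp: dual_sections_def)

lemma smooth_sections_fibre: "X \<in> smooth_sections A \<Longrightarrow> X x \<in> fibre A x"
  by (auto simp: smooth_sections_def)

lemma bivector_combination:
  assumes "\<pi> \<in> bivectors A" "\<xi> \<in> dual_fibre A x" "\<eta> \<in> dual_fibre A x" "\<zeta> \<in> dual_fibre A x"
  shows "\<pi> x (\<lambda>v. a * \<xi> v + b * \<eta> v) \<zeta> = a * \<pi> x \<xi> \<zeta> + b * \<pi> x \<eta> \<zeta>"
    and "\<pi> x \<zeta> (\<lambda>v. a * \<xi> v + b * \<eta> v) = a * \<pi> x \<zeta> \<xi> + b * \<pi> x \<zeta> \<eta>"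
  using assms unfolding bivectors_def by blast+

text \<open>Polarization of the alternating condition on the sum of the two covectors. The factors 1
  give this sum the shape of \<open>bivector_combination\<close>.\<close>

lemma bivector_antisym:
  assumes \<pi>: "\<pi> \<in> bivectors A" and \<xi>: "\<xi> \<in> dual_fibre A x" and \<eta>: "\<eta> \<in> dual_fibre A x"
  shows "\<pi> x \<xi> \<eta> = - \<pi> x \<eta> \<xi>"
proof -
  have z: "\<pi> x \<zeta> \<zeta> = 0" if "\<zeta> \<in> dual_fibre A x" for \<zeta>
    using \<pi> that by (auto simp: bivectors_def)
  let ?s = "\<lambda>v. 1 * \<xi> v + 1 * \<eta> v"
  have s: "?s \<in> dual_fibre A x" using \<xi> \<eta> by (rule dual_fibre_lin)
  have "0 = \<pi> x ?s ?s" using z[OF s] by simp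
  also have "\<dots> = 1 * \<pi> x \<xi> ?s + 1 * \<pi> x \<eta> ?s"
    by (rule bivector_combination[OF \<pi> \<xi> \<eta> s])
  also have "\<dots> = \<pi> x \<xi> \<eta> + \<pi> x \<eta> \<xi>"
    using bivector_combination(2)[OF \<pi> \<xi> \<eta> \<xi>, of 1 1] bivector_combination(2)[OF \<pi> \<xi> \<eta> \<eta>, of 1 1]
      z[OF \<xi>] z[OF \<eta>] by simp
  finally show ?thesis by simp
qed

lemma bivector_sum_right:
  assumes \<pi>: "\<pi> \<in> bivectors A" and \<zeta>: "\<zeta> \<in> dual_fibre A x"
    and "\<And>j. j \<in> J \<Longrightarrow> \<xi> j \<in> dual_fibre A x"
  shows "\<pi> x \<zeta> (\<lambda>v. \<Sum>j\<in>J. c j * \<xi> j v) = (\<Sum>j\<in>J. c j * \<pi> x \<zeta> (\<xi> j))"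
proof -
  have 0: "\<pi> x \<zeta> (\<lambda>v. 0) = 0"
    using bivector_combination(2)[OF \<pi> dual_fibre_0 dual_fibre_0 \<zeta>, of 0 0] by simp
  show ?thesis using assms(3)
  proof (induction J rule: infinite_finite_induct)
    case (insert k J)
    then have "(\<lambda>v. \<Sum>j\<in>J. c j * \<xi> j v) \<in> dual_fibre A x" by (intro dual_fibre_sum) auto
    then show ?case
      using insert bivector_combination(2)[OF \<pi> _ _ \<zeta>, of "\<xi> k" "\<lambda>v. \<Sum>j\<in>J. c j * \<xi> j v" "c k" 1]
      by simp
  qed (auto simp: 0)
qed

lemma bivector_sum_left:
  assumes \<pi>: "\<pi> \<in> bivectors A" and \<zeta>: "\<zeta> \<in> dual_fibre A x"
    and \<xi>: "\<And>j. j \<in> J \<Longrightarrow> \<xi> j \<in> dual_fibre A x"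
  shows "\<pi> x (\<lambda>v. \<Sum>j\<in>J. c j * \<xi> j v) \<zeta> = (\<Sum>j\<in>J. c j * \<pi> x (\<xi> j) \<zeta>)"
proof -
  have "\<pi> x (\<lambda>v. \<Sum>j\<in>J. c j * \<xi> j v) \<zeta> = - (\<Sum>j\<in>J. c j * \<pi> x \<zeta> (\<xi> j))"
    using bivector_antisym[OF \<pi> dual_fibre_sum[of J \<xi> A x c] \<zeta>]
      bivector_sum_right[OF \<pi> \<zeta>, of J \<xi> c] \<xi> by simp
  also have "\<dots> = (\<Sum>j\<in>J. c j * \<pi> x (\<xi> j) \<zeta>)"
    unfolding sum_negf[symmetric]
    by (rule sum.cong) (use bivector_antisym[OF \<pi> \<zeta> \<xi>] in auto)
  finally show ?thesis .
qed

section \<open>Trivialisations, frames and coframes\<close>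

locale vector_bundle =
  fixes A :: "('m::{t2_space, second_countable_topology}, 'e::euclidean_space, 'v::real_vector, 'z)
                bundle_data_scheme"
  assumes smooth_bundle: "smooth_vector_bundle A"
begin

lemma manifold: "smooth_manifold A"
  using smooth_bundle by (simp add: smooth_vector_bundle_def)

lemma subspace_fibre: "subspace (fibre A x)"
  using smooth_bundle by (simp add: smooth_vector_bundle_def)

lemma trivE:
  obtains U \<Phi> where "(U, \<Phi>) \<in> trivs A" "x \<in> U"
proof -
  have "(\<Union>(U, \<Phi>)\<in>trivs A. U) = UNIV" using smooth_bundle by (simp add: smooth_vector_bundle_def)
  then have "x \<in> (\<Union>(U, \<Phi>)\<in>trivs A. U)" by simp
  with that show ?thesis by auto
qed

context
  fixes U \<Phi> assumes U: "(U, \<Phi>) \<in> trivs A"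
begin

lemma triv_props:
  "open U \<and> (\<forall>x\<in>U. bij_betw (\<Phi> x) (fibre A x) (Rn (rank A)) \<and>
           (\<forall>v\<in>fibre A x. \<forall>w\<in>fibre A x. \<forall>a b i.
              \<Phi> x (a *\<^sub>R v + b *\<^sub>R w) i = a * \<Phi> x v i + b * \<Phi> x w i))"
proof -
  have "\<forall>(U, \<Phi>)\<in>trivs A.
        open U \<and>
        (\<forall>x\<in>U. bij_betw (\<Phi> x) (fibre A x) (Rn (rank A)) \<and>
           (\<forall>v\<in>fibre A x. \<forall>w\<in>fibre A x. \<forall>a b i.
              \<Phi> x (a *\<^sub>R v + b *\<^sub>R w) i = a * \<Phi> x v i + b * \<Phi> x w i))"
    using smooth_bundle unfolding smooth_vector_bundle_def by (elim conjE)
  with U show ?thesis by blast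
qed

lemma open_triv: "open U"
  using triv_props by blast

lemma smooth_transition:
  assumes "(V, \<Psi>) \<in> trivs A" "i < rank A" "j < rank A"
  shows "smooth_fun_on A (U \<inter> V) (\<lambda>x. \<Psi> x (frame A \<Phi> j x) i)"
proof -
  have "\<forall>(U, \<Phi>)\<in>trivs A. \<forall>(V, \<Psi>)\<in>trivs A. \<forall>i<rank A. \<forall>j<rank A.
        smooth_fun_on A (U \<inter> V) (\<lambda>x. \<Psi> x (frame A \<Phi> j x) i)"
    using smooth_bundle unfolding smooth_vector_bundle_def by (elim conjE)
  with U assms show ?thesis by fast
qed

context
  fixes x assumes x: "x \<in> U"
begin

lemma triv_bij: "bij_betw (\<Phi> x) (fibre A x) (Rn (rank A))"
  using triv_props x by blast

lemma triv_combination: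
  "v \<in> fibre A x \<Longrightarrow> w \<in> fibre A x \<Longrightarrow> \<Phi> x (a *\<^sub>R v + b *\<^sub>R w) i = a * \<Phi> x v i + b * \<Phi> x w i"
  using triv_props x by blast

lemma triv_add: "v \<in> fibre A x \<Longrightarrow> w \<in> fibre A x \<Longrightarrow> \<Phi> x (v + w) i = \<Phi> x v i + \<Phi> x w i"
  using triv_combination[of v w 1 1] by simp

lemma triv_scale: "v \<in> fibre A x \<Longrightarrow> \<Phi> x (a *\<^sub>R v) i = a * \<Phi> x v i"
  using triv_combination[of v v a 0] by simp

lemma triv_zero: "\<Phi> x 0 i = 0"
  using triv_scale[of 0 0] subspace_0[OF subspace_fibre] by simp

lemma triv_beyond: "v \<in> fibre A x \<Longrightarrow> rank A \<le> i \<Longrightarrow> \<Phi> x v i = 0"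
  using bij_betw_apply[OF triv_bij] by (auto simp: Rn_def)

lemma
  assumes "j < rank A"
  shows frame_in_fibre: "frame A \<Phi> j x \<in> fibre A x"
    and triv_frame: "\<Phi> x (frame A \<Phi> j x) = unit_vec j"
proof -
  have "unit_vec j \<in> \<Phi> x ` fibre A x"
    using bij_betw_imp_surj_on[OF triv_bij] assms by (auto simp: Rn_def unit_vec_def)
  then show "frame A \<Phi> j x \<in> fibre A x" "\<Phi> x (frame A \<Phi> j x) = unit_vec j"
    unfolding frame_def by (auto intro: inv_into_into f_inv_into_f)
qed

lemma frame_expansion:
  assumes v: "v \<in> fibre A x"
  shows "v = (\<Sum>j<rank A. \<Phi> x v j *\<^sub>R frame A \<Phi> j x)" (is "v = ?w")
proof (rule inj_onD[OF bij_betw_imp_inj_on[OF triv_bij] _ v])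
  show w: "?w \<in> fibre A x"
    by (intro subspace_sum[OF subspace_fibre] subspace_scale[OF subspace_fibre] frame_in_fibre) auto
  show "\<Phi> x v = \<Phi> x ?w"
  proof
    fix i
    have "\<Phi> x ?w i = (\<Sum>j<rank A. \<Phi> x v j * \<Phi> x (frame A \<Phi> j x) i)"
      by (rule linear_combination_sum[OF subspace_fibre[of x], where g = "\<lambda>v. \<Phi> x v i"])
        (auto intro: triv_combination frame_in_fibre)
    also have "\<dots> = (\<Sum>j<rank A. if j = i then \<Phi> x v j else 0)"
      by (rule sum.cong) (auto simp: triv_frame unit_vec_def)
    \<comment> \<open>For \<open>i\<close> at or beyond the rank no term of the sum survives, and
      the coordinate is 0 as well because \<open>\<Phi> x\<close> maps into
      \<open>Rn (rank A)\<close>.\<close>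
    also have "\<dots> = \<Phi> x v i"
      using triv_beyond[OF v, of i] by auto
    finally show "\<Phi> x v i = \<Phi> x ?w i" by simp
  qed
qed

lemma coframe_in_dual_fibre: "coframe A \<Phi> i x \<in> dual_fibre A x"
  unfolding dual_fibre_def coframe_def
  using triv_combination subspace_fibre[of x] by (auto simp: subspace_add subspace_scale)

lemma dual_apply:
  assumes "\<eta> \<in> dual_fibre A x" "v \<in> fibre A x"
  shows "\<eta> v = (\<Sum>j<rank A. \<Phi> x v j * \<eta> (frame A \<Phi> j x))"
proof -
  have "\<eta> (\<Sum>j<rank A. \<Phi> x v j *\<^sub>R frame A \<Phi> j x) = (\<Sum>j<rank A. \<Phi> x v j * \<eta> (frame A \<Phi> j x))"
    by (rule linear_combination_sum[OF subspace_fibre[of x]])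
      (auto intro: dual_fibre_combination[OF assms(1)] frame_in_fibre)
  with arg_cong[OF frame_expansion[OF assms(2)], of \<eta>] show ?thesis by (rule trans)
qed

lemma dual_expansion:
  assumes "\<eta> \<in> dual_fibre A x"
  shows "\<eta> = (\<lambda>v. \<Sum>j<rank A. \<eta> (frame A \<Phi> j x) * coframe A \<Phi> j x v)"
proof
  fix v
  show "\<eta> v = (\<Sum>j<rank A. \<eta> (frame A \<Phi> j x) * coframe A \<Phi> j x v)"
  proof (cases "v \<in> fibre A x")
    case True
    then show ?thesis using dual_apply[OF assms True] by (simp add: coframe_def mult.commute)
  next
    case False
    then show ?thesis using assms by (simp add: coframe_def dual_fibre_def)
  qed
qed

end

end

text \<open>Coordinates extend to covectors, the coframe, and \<open>\<Phi> x\<close> is injective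
  on the fibre, so covectors separate vectors. This provides the uniqueness in the definite
  description of \<open>sharp\<close>.\<close>

lemma fibre_eqI:
  assumes v: "v \<in> fibre A x" and w: "w \<in> fibre A x"
    and eq: "\<And>\<eta>. \<eta> \<in> dual_fibre A x \<Longrightarrow> \<eta> v = \<eta> w"
  shows "v = w"
proof -
  obtain U \<Phi> where U: "(U, \<Phi>) \<in> trivs A" "x \<in> U" by (rule trivE)
  have "\<Phi> x v i = \<Phi> x w i" for i
    using eq[OF coframe_in_dual_fibre[OF U, of i]] v w by (simp add: coframe_def)
  then show ?thesis
    using inj_onD[OF bij_betw_imp_inj_on[OF triv_bij[OF U]] _ v w] by blast
qed

section \<open>The map from covectors to vectors given by a bivector\<close>

lemma sharp_eqI:
  assumes "v \<in> fibre A x" "\<And>\<eta>. \<eta> \<in> dual_fibre A x \<Longrightarrow> \<eta> v = \<pi> x (\<xi> x) \<eta>"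
  shows "sharp A \<pi> \<xi> x = v"
  unfolding sharp_def
proof (rule the_equality)
  show "v \<in> fibre A x \<and> (\<forall>\<eta>\<in>dual_fibre A x. \<eta> v = \<pi> x (\<xi> x) \<eta>)"
    using assms by blast
  fix w assume w: "w \<in> fibre A x \<and> (\<forall>\<eta>\<in>dual_fibre A x. \<eta> w = \<pi> x (\<xi> x) \<eta>)"
  show "w = v"
  proof (rule fibre_eqI)
    show "\<eta> w = \<eta> v" if "\<eta> \<in> dual_fibre A x" for \<eta>
      using w assms(2)[OF that] that by simp
  qed (use w assms(1) in auto)
qed

text \<open>The vector is obtained by evaluating \<open>\<pi> x (\<xi> x)\<close> on the coframe and
  using the values as coefficients of the frame. Testing it with \<eta> and expanding \<eta> in the
  coframe gives back the value of the bivector. Only the covector at \<open>x\<close> enters, so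
  \<xi> may be any field of covectors there.\<close>

lemma
  assumes \<pi>: "\<pi> \<in> bivectors A" and \<xi>: "\<xi> x \<in> dual_fibre A x"
  shows sharp_in_fibre: "sharp A \<pi> \<xi> x \<in> fibre A x"
    and sharp_apply: "\<eta> \<in> dual_fibre A x \<Longrightarrow> \<eta> (sharp A \<pi> \<xi> x) = \<pi> x (\<xi> x) \<eta>"
proof -
  obtain U \<Phi> where U: "(U, \<Phi>) \<in> trivs A" "x \<in> U" by (rule trivE)
  define v where "v = (\<Sum>j<rank A. \<pi> x (\<xi> x) (coframe A \<Phi> j x) *\<^sub>R frame A \<Phi> j x)"
  have v: "v \<in> fibre A x"
    unfolding v_def
    by (intro subspace_sum[OF subspace_fibre] subspace_scale[OF subspace_fibre] frame_in_fibre[OF U])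
      auto
  have \<eta>: "\<eta> v = \<pi> x (\<xi> x) \<eta>" if \<eta>: "\<eta> \<in> dual_fibre A x" for \<eta>
  proof -
    have "\<eta> v = (\<Sum>j<rank A. \<pi> x (\<xi> x) (coframe A \<Phi> j x) * \<eta> (frame A \<Phi> j x))"
      unfolding v_def
      by (rule linear_combination_sum[OF subspace_fibre[of x]])
        (auto intro: dual_fibre_combination[OF \<eta>] frame_in_fibre[OF U])
    also have "\<dots> = (\<Sum>j<rank A. \<eta> (frame A \<Phi> j x) * \<pi> x (\<xi> x) (coframe A \<Phi> j x))"
      by (simp add: mult.commute)
    also have "\<dots> = \<pi> x (\<xi> x) (\<lambda>v. \<Sum>j<rank A. \<eta> (frame A \<Phi> j x) * coframe A \<Phi> j x v)"
      by (rule bivector_sum_right[OF \<pi> \<xi>, symmetric]) (rule coframe_in_dual_fibre[OF U])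
    also have "\<dots> = \<pi> x (\<xi> x) \<eta>"
      by (rule arg_cong[OF dual_expansion[OF U \<eta>, symmetric]])
    finally show ?thesis .
  qed
  have s: "sharp A \<pi> \<xi> x = v" using v \<eta> by (rule sharp_eqI)
  show "sharp A \<pi> \<xi> x \<in> fibre A x" using s v by simp
  show "\<eta> (sharp A \<pi> \<xi> x) = \<pi> x (\<xi> x) \<eta>" if "\<eta> \<in> dual_fibre A x" using s \<eta>[OF that] by simp
qed

text \<open>Skewness in the form that moves the map of \<pi> from one covector to the other. Both
  the membership in the dual relation and the cancellation of the covector brackets rest on
  it.\<close>

lemma sharp_skew:
  assumes "\<pi> \<in> bivectors A" "\<xi> x \<in> dual_fibre A x" "\<eta> x \<in> dual_fibre A x"
  shows "\<eta> x (sharp A \<pi> \<xi> x) = - \<xi> x (sharp A \<pi> \<eta> x)"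
  using sharp_apply[where \<xi> = \<xi>, OF assms] sharp_apply[where \<xi> = \<eta>, OF assms(1,3,2)]
    bivector_antisym[OF assms] by simp

lemma sharp_biv_add:
  assumes "\<pi> \<in> bivectors A" "\<pi>' \<in> bivectors A" "\<xi> x \<in> dual_fibre A x"
  shows "sharp A (biv_add \<pi> \<pi>') \<xi> x = sharp A \<pi> \<xi> x + sharp A \<pi>' \<xi> x"
proof (rule sharp_eqI)
  note f = sharp_in_fibre[where \<xi> = \<xi>, OF assms(1,3)] sharp_in_fibre[where \<xi> = \<xi>, OF assms(2,3)]
  show "sharp A \<pi> \<xi> x + sharp A \<pi>' \<xi> x \<in> fibre A x"
    using f subspace_add[OF subspace_fibre] by blast
  show "\<eta> (sharp A \<pi> \<xi> x + sharp A \<pi>' \<xi> x) = biv_add \<pi> \<pi>' x (\<xi> x) \<eta>"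
    if "\<eta> \<in> dual_fibre A x" for \<eta>
    using dual_fibre_combination[OF that f, of 1 1]
      sharp_apply[where \<xi> = \<xi>, OF assms(1,3) that] sharp_apply[where \<xi> = \<xi>, OF assms(2,3) that]
    by (simp add: biv_add_def)
qed

lemma sharp_add:
  assumes \<pi>: "\<pi> \<in> bivectors A" and \<xi>: "\<xi> x \<in> dual_fibre A x" and \<eta>: "\<eta> x \<in> dual_fibre A x"
  shows "sharp A \<pi> (\<lambda>x v. \<xi> x v + \<eta> x v) x = sharp A \<pi> \<xi> x + sharp A \<pi> \<eta> x"
proof (rule sharp_eqI)
  note f = sharp_in_fibre[where \<xi> = \<xi>, OF \<pi> \<xi>] sharp_in_fibre[where \<xi> = \<eta>, OF \<pi> \<eta>]
  show "sharp A \<pi> \<xi> x + sharp A \<pi> \<eta> x \<in> fibre A x"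
    using f subspace_add[OF subspace_fibre] by blast
  show "\<zeta> (sharp A \<pi> \<xi> x + sharp A \<pi> \<eta> x) = \<pi> x (\<lambda>v. \<xi> x v + \<eta> x v) \<zeta>"
    if "\<zeta> \<in> dual_fibre A x" for \<zeta>
    using dual_fibre_combination[OF that f, of 1 1] bivector_combination(1)[OF \<pi> \<xi> \<eta> that, of 1 1]
      sharp_apply[where \<xi> = \<xi>, OF \<pi> \<xi> that] sharp_apply[where \<xi> = \<eta>, OF \<pi> \<eta> that] by simp
qed

section \<open>Smooth sections and their pairings\<close>

lemma smooth_section_triv:
  "X \<in> smooth_sections A \<Longrightarrow> (U, \<Phi>) \<in> trivs A \<Longrightarrow> i < rank A \<Longrightarrow>
     smooth_fun_on A U (\<lambda>x. \<Phi> x (X x) i)"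
  unfolding smooth_sections_def by blast

lemma smooth_dual_frame:
  "\<alpha> \<in> dual_sections A \<Longrightarrow> (U, \<Phi>) \<in> trivs A \<Longrightarrow> i < rank A \<Longrightarrow>
     smooth_fun_on A U (\<lambda>x. \<alpha> x (frame A \<Phi> i x))"
  unfolding dual_sections_def by blast

text \<open>Over a trivialisation the components of the image are sums of components of \<xi> times
  matrix entries of \<pi>, which are smooth by the definitions of the two spaces.\<close>

lemma sharp_section:
  assumes \<pi>: "\<pi> \<in> bivectors A" and \<xi>: "\<xi> \<in> dual_sections A"
  shows "sharp A \<pi> \<xi> \<in> smooth_sections A"
  unfolding smooth_sections_def
proof (clarify, intro conjI allI ballI; clarify?)
  show "sharp A \<pi> \<xi> x \<in> fibre A x" for x
    using sharp_in_fibre \<pi> dual_sections_fibre[OF \<xi>] by blast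
  fix U \<Phi> i assume U: "(U, \<Phi>) \<in> trivs A" and i: "i < rank A"
  have eq: "(\<Sum>j<rank A. \<xi> x (frame A \<Phi> j x) * \<pi> x (coframe A \<Phi> j x) (coframe A \<Phi> i x)) =
      \<Phi> x (sharp A \<pi> \<xi> x) i" if x: "x \<in> U" for x
  proof -
    note c = coframe_in_dual_fibre[OF U x]
    have "\<Phi> x (sharp A \<pi> \<xi> x) i = \<pi> x (\<xi> x) (coframe A \<Phi> i x)"
      using sharp_apply[where \<xi> = \<xi>, OF \<pi> dual_sections_fibre[OF \<xi>] c]
        sharp_in_fibre[where \<xi> = \<xi>, OF \<pi> dual_sections_fibre[OF \<xi>]]
      by (simp add: coframe_def)
    also have "\<dots> = \<pi> x (\<lambda>v. \<Sum>j<rank A. \<xi> x (frame A \<Phi> j x) * coframe A \<Phi> j x v) (coframe A \<Phi> i x)"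
      by (rule arg_cong[OF dual_expansion[OF U x dual_sections_fibre[OF \<xi>]]])
    also have "\<dots> = (\<Sum>j<rank A. \<xi> x (frame A \<Phi> j x) * \<pi> x (coframe A \<Phi> j x) (coframe A \<Phi> i x))"
      by (rule bivector_sum_left[OF \<pi> c c])
    finally show ?thesis by (rule sym)
  qed
  have "smooth_fun_on A U (\<lambda>x. \<pi> x (coframe A \<Phi> j x) (coframe A \<Phi> i x))" if "j < rank A" for j
    using \<pi> U i that unfolding bivectors_def by fast
  then have "smooth_fun_on A U
      (\<lambda>x. \<Sum>j<rank A. \<xi> x (frame A \<Phi> j x) * \<pi> x (coframe A \<Phi> j x) (coframe A \<Phi> i x))"
    by (intro smooth_fun_on_sum smooth_fun_on_mult smooth_dual_frame[OF \<xi> U]) auto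
  then show "smooth_fun_on A U (\<lambda>x. \<Phi> x (sharp A \<pi> \<xi> x) i)"
    by (rule smooth_fun_on_cong[OF manifold, rotated]) (rule eq)
qed

lemma smooth_pairing:
  assumes \<alpha>: "\<alpha> \<in> dual_sections A" and X: "X \<in> smooth_sections A"
  shows "smooth_fun A (pairing \<alpha> X)"
proof (rule smooth_fun_on_local[OF manifold])
  fix x
  obtain U \<Phi> where U: "(U, \<Phi>) \<in> trivs A" "x \<in> U" by (rule trivE)
  have "smooth_fun_on A U (\<lambda>x. \<Sum>j<rank A. \<Phi> x (X x) j * \<alpha> x (frame A \<Phi> j x))"
    by (intro smooth_fun_on_sum smooth_fun_on_mult smooth_dual_frame[OF \<alpha> U(1)]
        smooth_section_triv[OF X U(1)]) auto
  then have "smooth_fun_on A U (pairing \<alpha> X)"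
    by (rule smooth_fun_on_cong[OF manifold, rotated])
      (simp add: pairing_def
        dual_apply[OF U(1) _ dual_sections_fibre[OF \<alpha>] smooth_sections_fibre[OF X]])
  then show "\<exists>N. open N \<and> x \<in> N \<and> smooth_fun_on A (UNIV \<inter> N) (pairing \<alpha> X)"
    using U open_triv by auto
qed simp

lemma smooth_bivector_apply:
  assumes "\<pi> \<in> bivectors A" "\<xi> \<in> dual_sections A" "\<eta> \<in> dual_sections A"
  shows "smooth_fun A (\<lambda>x. \<pi> x (\<xi> x) (\<eta> x))"
proof -
  have "pairing \<eta> (sharp A \<pi> \<xi>) = (\<lambda>x. \<pi> x (\<xi> x) (\<eta> x))"
    unfolding pairing_def by (intro ext sharp_apply dual_sections_fibre assms)
  then show ?thesis using smooth_pairing[OF assms(3) sharp_section[OF assms(1,2)]] by simp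
qed

lemma smooth_sections_scale:
  assumes X: "X \<in> smooth_sections A" and f: "smooth_fun A f"
  shows "(\<lambda>x. f x *\<^sub>R X x) \<in> smooth_sections A"
  unfolding smooth_sections_def
proof (clarify, intro conjI allI ballI; clarify?)
  show "f x *\<^sub>R X x \<in> fibre A x" for x
    by (rule subspace_scale[OF subspace_fibre smooth_sections_fibre[OF X]])
  fix U \<Phi> i assume U: "(U, \<Phi>) \<in> trivs A" and i: "i < rank A"
  have "smooth_fun_on A U (\<lambda>x. f x * \<Phi> x (X x) i)"
    by (intro smooth_fun_on_mult smooth_section_triv[OF X U i] smooth_fun_imp_on[OF f])
  then show "smooth_fun_on A U (\<lambda>x. \<Phi> x (f x *\<^sub>R X x) i)"
    by (rule smooth_fun_on_cong[OF manifold, rotated])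
      (simp add: triv_scale[OF U _ smooth_sections_fibre[OF X]])
qed

lemma smooth_sections_add:
  assumes X: "X \<in> smooth_sections A" and Y: "Y \<in> smooth_sections A"
  shows "(\<lambda>x. X x + Y x) \<in> smooth_sections A"
  unfolding smooth_sections_def
proof (clarify, intro conjI allI ballI; clarify?)
  show "X x + Y x \<in> fibre A x" for x
    by (rule subspace_add[OF subspace_fibre smooth_sections_fibre[OF X] smooth_sections_fibre[OF Y]])
  fix U \<Phi> i assume U: "(U, \<Phi>) \<in> trivs A" and i: "i < rank A"
  have "smooth_fun_on A U (\<lambda>x. \<Phi> x (X x) i + \<Phi> x (Y x) i)"
    by (rule smooth_fun_on_add[OF smooth_section_triv[OF X U i] smooth_section_triv[OF Y U i]])
  then show "smooth_fun_on A U (\<lambda>x. \<Phi> x (X x + Y x) i)"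
    by (rule smooth_fun_on_cong[OF manifold, rotated])
      (simp add: triv_add[OF U _ smooth_sections_fibre[OF X] smooth_sections_fibre[OF Y]])
qed

lemma smooth_sections_zero: "(\<lambda>x. 0) \<in> smooth_sections A"
  unfolding smooth_sections_def
proof (clarify, intro conjI allI ballI; clarify?)
  show "0 \<in> fibre A x" for x using subspace_0[OF subspace_fibre] .
  fix U \<Phi> i assume U: "(U, \<Phi>) \<in> trivs A"
  show "smooth_fun_on A U (\<lambda>x. \<Phi> x 0 i)"
    by (rule smooth_fun_on_cong[OF manifold _ smooth_fun_on_const[of A U 0]])
      (simp add: triv_zero[OF U])
qed

lemma smooth_sections_sum:
  "(\<And>i. i \<in> I \<Longrightarrow> X i \<in> smooth_sections A) \<Longrightarrow> (\<lambda>x. \<Sum>i\<in>I. X i x) \<in> smooth_sections A"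
  by (induction I rule: infinite_finite_induct)
    (auto intro: smooth_sections_zero smooth_sections_add)

section \<open>Cutting off local frames; sections through a given vector\<close>

context
  fixes U \<Phi> K \<rho>
  assumes U: "(U, \<Phi>) \<in> trivs A" and K: "closed K" "K \<subseteq> U"
    and \<rho>: "smooth_fun A \<rho>" "\<And>x. x \<notin> K \<Longrightarrow> \<rho> x = 0"
begin

text \<open>This makes a local frame field into an admissible argument of the bracket. In another
  trivialisation its components are \<rho> times entries of the transition matrix, and these extend
  by zero out of \<open>U\<close>; beyond \<open>U\<close> the unspecified value of
  \<open>frame\<close> is multiplied by 0.\<close>

lemma smooth_cutoff_frame:
  assumes j: "j < rank A"
  shows "(\<lambda>x. \<rho> x *\<^sub>R frame A \<Phi> j x) \<in> smooth_sections A"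
  unfolding smooth_sections_def
proof (clarify, intro conjI allI ballI; clarify?)
  have in_U: "x \<in> U" if "\<rho> x \<noteq> 0" for x using \<rho>(2) K that by blast
  show "\<rho> x *\<^sub>R frame A \<Phi> j x \<in> fibre A x" for x
    using frame_in_fibre[OF U in_U j] subspace_0[OF subspace_fibre] subspace_scale[OF subspace_fibre]
    by (cases "\<rho> x = 0") auto
  fix V \<Psi> i assume V: "(V, \<Psi>) \<in> trivs A" and i: "i < rank A"
  have "smooth_fun_on A V (\<lambda>x. \<rho> x * \<Psi> x (frame A \<Phi> j x) i)"
    by (intro smooth_fun_on_mult_support[OF manifold open_triv[OF V] K open_triv[OF U]]
        smooth_fun_imp_on[OF \<rho>(1)] \<rho>(2) smooth_transition[OF U V i j])
  then show "smooth_fun_on A V (\<lambda>x. \<Psi> x (\<rho> x *\<^sub>R frame A \<Phi> j x) i)"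
  proof (rule smooth_fun_on_cong[OF manifold, rotated])
    fix x assume "x \<in> V"
    then show "\<rho> x * \<Psi> x (frame A \<Phi> j x) i = \<Psi> x (\<rho> x *\<^sub>R frame A \<Phi> j x) i"
      using triv_scale[OF V _ frame_in_fibre[OF U in_U j]] triv_zero[OF V]
      by (cases "\<rho> x = 0") auto
  qed
qed

lemma smooth_cutoff_coordinate:
  assumes X: "X \<in> smooth_sections A" and j: "j < rank A"
  shows "smooth_fun A (\<lambda>x. \<rho> x * \<Phi> x (X x) j)"
  using smooth_section_triv[OF X U j]
  by (intro smooth_fun_on_mult_support[OF manifold open_UNIV K open_triv[OF U]]
      smooth_fun_imp_on[OF \<rho>(1)] \<rho>(2)) auto

end

lemma section_through:
  assumes v: "v \<in> fibre A p"
  shows "\<exists>X\<in>smooth_sections A. X p = v"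
proof -
  obtain U \<Phi> where U: "(U, \<Phi>) \<in> trivs A" "p \<in> U" by (rule trivE)
  obtain \<rho> K N where \<rho>: "smooth_fun A \<rho>" "closed K" "K \<subseteq> U" "\<And>x. x \<notin> K \<Longrightarrow> \<rho> x = 0"
    "open N" "p \<in> N" "\<And>x. x \<in> N \<Longrightarrow> \<rho> x \<noteq> 0"
    using smooth_bump[OF manifold open_triv[OF U(1)] U(2)] by metis
  \<comment> \<open>Dividing by \<open>\<rho> p\<close> normalises the cutoff frame at
    \<open>p\<close>, where \<rho> is nonzero but need not be 1.\<close>
  define X where "X x = (\<Sum>j<rank A. (\<Phi> p v j / \<rho> p) *\<^sub>R (\<rho> x *\<^sub>R frame A \<Phi> j x))" for x
  have "X \<in> smooth_sections A"
    unfolding X_def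
    by (intro smooth_sections_sum smooth_sections_scale smooth_fun_on_const
        smooth_cutoff_frame[OF U(1) \<rho>(2,3,1,4)]) auto
  moreover have "X p = v"
    using \<rho>(7)[OF \<rho>(6)] by (simp add: X_def flip: frame_expansion[OF U v])
  ultimately show ?thesis by blast
qed

text \<open>Every vector of the fibre is the value of a global section, and off the fibre covectors
  are 0 by convention. An identity tested on sections thus becomes an equality of covectors, as the
  uniqueness of the Lie derivative requires.\<close>

lemma dual_fibre_eqI:
  assumes "\<eta> \<in> dual_fibre A x" "\<zeta> \<in> dual_fibre A x"
    and "\<And>X. X \<in> smooth_sections A \<Longrightarrow> \<eta> (X x) = \<zeta> (X x)"
  shows "\<eta> = \<zeta>"
proof
  fix v show "\<eta> v = \<zeta> v"
  proof (cases "v \<in> fibre A x")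
    case True
    then show ?thesis using section_through assms(3) by metis
  next
    case False
    then show ?thesis using assms(1,2) by (simp add: dual_fibre_def)
  qed
qed

end

section \<open>Lie derivatives and the Schouten bracket\<close>

locale algebroid =
  fixes A :: "('m::{t2_space, second_countable_topology}, 'e::euclidean_space, 'v::real_vector, 'z)
                algebroid_data_scheme"
  assumes algebroid: "lie_algebroid A"
begin

sublocale vector_bundle A
  using algebroid by unfold_locales (simp add: lie_algebroid_def)

section \<open>Rules for the anchor and the bracket\<close>

lemma anchor_tangent: "v \<in> fibre A x \<Longrightarrow> anchor A x v \<in> tangent_vectors A x"
  by (rule algebroid[unfolded lie_algebroid_def, THEN conjunct2, THEN conjunct1, rule_format])

lemma anchor_combination:
  "v \<in> fibre A x \<Longrightarrow> w \<in> fibre A x \<Longrightarrow> smooth_fun A f \<Longrightarrow>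
     anchor A x (a *\<^sub>R v + b *\<^sub>R w) f = a * anchor A x v f + b * anchor A x w f"
  by (rule algebroid[unfolded lie_algebroid_def, THEN conjunct2, THEN conjunct2, THEN conjunct1, rule_format])

lemma smooth_anchor_deriv:
  "X \<in> smooth_sections A \<Longrightarrow> smooth_fun A f \<Longrightarrow> smooth_fun A (anchor_deriv A X f)"
  by (rule algebroid[unfolded lie_algebroid_def, THEN conjunct2, THEN conjunct2, THEN conjunct2, THEN conjunct1, rule_format])

lemma bracket_section:
  "X \<in> smooth_sections A \<Longrightarrow> Y \<in> smooth_sections A \<Longrightarrow> bracket A X Y \<in> smooth_sections A"
  by (rule algebroid[unfolded lie_algebroid_def, THEN conjunct2, THEN conjunct2, THEN conjunct2, THEN conjunct2, THEN conjunct1, rule_format])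

lemma bracket_add_left:
  assumes "X \<in> smooth_sections A" "Y \<in> smooth_sections A" "Z \<in> smooth_sections A"
  shows "bracket A (\<lambda>x. X x + Y x) Z = (\<lambda>x. bracket A X Z x + bracket A Y Z x)"
proof -
  have "bracket A (\<lambda>x. 1 *\<^sub>R X x + 1 *\<^sub>R Y x) Z =
      (\<lambda>x. 1 *\<^sub>R bracket A X Z x + 1 *\<^sub>R bracket A Y Z x)"
    by (rule algebroid[unfolded lie_algebroid_def, THEN conjunct2, THEN conjunct2, THEN conjunct2, THEN conjunct2, THEN conjunct2, THEN conjunct1, rule_format]) fact+
  then show ?thesis by simp
qed

lemma bracket_antisym:
  "X \<in> smooth_sections A \<Longrightarrow> Y \<in> smooth_sections A \<Longrightarrow> bracket A X Y = (\<lambda>x. - bracket A Y X x)"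
  by (rule algebroid[unfolded lie_algebroid_def, THEN conjunct2, THEN conjunct2, THEN conjunct2, THEN conjunct2, THEN conjunct2, THEN conjunct2, THEN conjunct1, rule_format])

lemma bracket_add_right:
  assumes "X \<in> smooth_sections A" "Y \<in> smooth_sections A" "Z \<in> smooth_sections A"
  shows "bracket A X (\<lambda>x. Y x + Z x) = (\<lambda>x. bracket A X Y x + bracket A X Z x)"
  using bracket_antisym[OF assms(1) smooth_sections_add[OF assms(2,3)]]
    bracket_antisym[OF assms(1,2)] bracket_antisym[OF assms(1,3)]
    bracket_add_left[OF assms(2,3,1)] by simp

lemma bracket_leibniz:
  "X \<in> smooth_sections A \<Longrightarrow> Y \<in> smooth_sections A \<Longrightarrow> smooth_fun A f \<Longrightarrow>
     bracket A X (\<lambda>x. f x *\<^sub>R Y x) =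
       (\<lambda>x. f x *\<^sub>R bracket A X Y x + anchor_deriv A X f x *\<^sub>R Y x)"
  by (rule algebroid[unfolded lie_algebroid_def, THEN conjunct2, THEN conjunct2, THEN conjunct2, THEN conjunct2, THEN conjunct2, THEN conjunct2, THEN conjunct2, THEN conjunct2, rule_format])

lemma anchor_deriv_add:
  assumes "X \<in> smooth_sections A" "smooth_fun A f" "smooth_fun A g"
  shows "anchor_deriv A X (\<lambda>x. f x + g x) x = anchor_deriv A X f x + anchor_deriv A X g x"
proof -
  have "anchor A x (X x) (\<lambda>y. 1 * f y + 1 * g y) = 1 * anchor A x (X x) f + 1 * anchor A x (X x) g"
    using anchor_tangent[OF smooth_sections_fibre[OF assms(1)], of x] assms(2,3)
    unfolding tangent_vectors_def by blast
  then show ?thesis by (simp add: anchor_deriv_def)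
qed

lemma anchor_deriv_mult:
  assumes "X \<in> smooth_sections A" "smooth_fun A f" "smooth_fun A g"
  shows "anchor_deriv A X (\<lambda>x. f x * g x) x = f x * anchor_deriv A X g x + g x * anchor_deriv A X f x"
  using anchor_tangent[OF smooth_sections_fibre[OF assms(1)], of x] assms(2,3)
  unfolding tangent_vectors_def anchor_deriv_def by blast

lemma anchor_deriv_add_left:
  assumes "X \<in> smooth_sections A" "Y \<in> smooth_sections A" "smooth_fun A f"
  shows "anchor_deriv A (\<lambda>x. X x + Y x) f x = anchor_deriv A X f x + anchor_deriv A Y f x"
  using anchor_combination[of "X x" x "Y x" f 1 1] assms
  by (simp add: anchor_deriv_def smooth_sections_fibre)

section \<open>Tensoriality of the Lie derivative and its existence as a dual section\<close>

definition lie_pairing :: "('m \<Rightarrow> 'v) \<Rightarrow> ('m \<Rightarrow> 'v \<Rightarrow> real) \<Rightarrow> ('m \<Rightarrow> 'v) \<Rightarrow> 'm \<Rightarrow> real" where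
  "lie_pairing X \<alpha> Y = (\<lambda>x. anchor_deriv A X (pairing \<alpha> Y) x - pairing \<alpha> (bracket A X Y) x)"

lemma dual_add:
  "\<eta> \<in> dual_fibre A x \<Longrightarrow> v \<in> fibre A x \<Longrightarrow> w \<in> fibre A x \<Longrightarrow> \<eta> (v + w) = \<eta> v + \<eta> w"
  using dual_fibre_combination[of \<eta> A x v w 1 1] by simp

lemma dual_scale:
  "\<eta> \<in> dual_fibre A x \<Longrightarrow> v \<in> fibre A x \<Longrightarrow> \<eta> (a *\<^sub>R v) = a * \<eta> v"
  using dual_fibre_combination[of \<eta> A x v v a 0] by simp

context
  fixes X \<alpha>
  assumes X: "X \<in> smooth_sections A" and \<alpha>: "\<alpha> \<in> dual_sections A"
begin

lemma lie_pairing_add: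
  assumes Y: "Y \<in> smooth_sections A" and Z: "Z \<in> smooth_sections A"
  shows "lie_pairing X \<alpha> (\<lambda>x. Y x + Z x) x = lie_pairing X \<alpha> Y x + lie_pairing X \<alpha> Z x"
proof -
  have add: "pairing \<alpha> (\<lambda>x. V x + W x) = (\<lambda>x. pairing \<alpha> V x + pairing \<alpha> W x)"
    if "V \<in> smooth_sections A" "W \<in> smooth_sections A" for V W
    using that by (simp add: pairing_def dual_add[OF dual_sections_fibre[OF \<alpha>]] smooth_sections_fibre)
  show ?thesis
    unfolding lie_pairing_def
    using bracket_add_right[OF X Y Z] add[OF Y Z] add[OF bracket_section[OF X Y] bracket_section[OF X Z]]
      anchor_deriv_add[OF X smooth_pairing[OF \<alpha> Y] smooth_pairing[OF \<alpha> Z]]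
    by simp
qed

text \<open>The Leibniz rules of the anchor and of the bracket each contribute
  \<open>anchor_deriv A X f x * pairing \<alpha> Y x\<close>, with opposite signs. So an expression
  that differentiates \<open>Y\<close> is linear over smooth functions.\<close>

lemma lie_pairing_scale:
  assumes Y: "Y \<in> smooth_sections A" and f: "smooth_fun A f"
  shows "lie_pairing X \<alpha> (\<lambda>x. f x *\<^sub>R Y x) x = f x * lie_pairing X \<alpha> Y x"
proof -
  have p: "pairing \<alpha> (\<lambda>x. f x *\<^sub>R Y x) = (\<lambda>x. f x * pairing \<alpha> Y x)"
    using Y by (simp add: pairing_def dual_scale[OF dual_sections_fibre[OF \<alpha>]] smooth_sections_fibre)
  have "pairing \<alpha> (bracket A X (\<lambda>x. f x *\<^sub>R Y x)) x =
      f x * pairing \<alpha> (bracket A X Y) x + anchor_deriv A X f x * pairing \<alpha> Y x"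
    unfolding bracket_leibniz[OF X Y f] pairing_def
    by (rule dual_fibre_combination[OF dual_sections_fibre[OF \<alpha>]])
      (auto intro: smooth_sections_fibre Y bracket_section[OF X Y])
  then show ?thesis
    unfolding lie_pairing_def p anchor_deriv_mult[OF X f smooth_pairing[OF \<alpha> Y]]
    by (simp add: algebra_simps)
qed

lemma lie_pairing_zero: "lie_pairing X \<alpha> (\<lambda>x. 0) x = 0"
  using lie_pairing_scale[OF smooth_sections_zero smooth_fun_on_const[of _ _ 0]] by simp

lemma lie_pairing_sum:
  assumes "\<And>j. j \<in> J \<Longrightarrow> Y j \<in> smooth_sections A" "\<And>j. j \<in> J \<Longrightarrow> smooth_fun A (f j)"
  shows "lie_pairing X \<alpha> (\<lambda>x. \<Sum>j\<in>J. f j x *\<^sub>R Y j x) x = (\<Sum>j\<in>J. f j x * lie_pairing X \<alpha> (Y j) x)"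
  using assms
proof (induction J rule: infinite_finite_induct)
  case (insert k J)
  then have "(\<lambda>x. f k x *\<^sub>R Y k x) \<in> smooth_sections A"
    "(\<lambda>x. \<Sum>j\<in>J. f j x *\<^sub>R Y j x) \<in> smooth_sections A"
    by (auto intro!: smooth_sections_scale smooth_sections_sum)
  then show ?case using insert lie_pairing_add lie_pairing_scale by simp
qed (auto simp: lie_pairing_zero)

text \<open>
  Multiplying \<open>Y\<close> by the square of a bump function turns its local frame expansion into one with
  global coefficients and global sections.
\<close>

lemma lie_pairing_tensorial:
  assumes Y: "Y \<in> smooth_sections A" and "Y p = 0"
  shows "lie_pairing X \<alpha> Y p = 0"
proof -
  obtain U \<Phi> where U: "(U, \<Phi>) \<in> trivs A" "p \<in> U" by (rule trivE)
  obtain \<rho> K N where \<rho>: "smooth_fun A \<rho>" "closed K" "K \<subseteq> U" "\<And>x. x \<notin> K \<Longrightarrow> \<rho> x = 0"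
    "open N" "p \<in> N" "\<And>x. x \<in> N \<Longrightarrow> \<rho> x \<noteq> 0"
    using smooth_bump[OF manifold open_triv[OF U(1)] U(2)] by metis
  have eq: "(\<Sum>j<rank A. (\<rho> x * \<Phi> x (Y x) j) *\<^sub>R (\<rho> x *\<^sub>R frame A \<Phi> j x)) = (\<rho> x * \<rho> x) *\<^sub>R Y x" for x
  proof (cases "x \<in> U")
    case True
    have "(\<rho> x * \<rho> x) *\<^sub>R Y x = (\<rho> x * \<rho> x) *\<^sub>R (\<Sum>j<rank A. \<Phi> x (Y x) j *\<^sub>R frame A \<Phi> j x)"
      using frame_expansion[OF U(1) True smooth_sections_fibre[OF Y]] by simp
    then show ?thesis by (simp add: scaleR_sum_right mult_ac)
  next
    case False
    then have "\<rho> x = 0" using \<rho>(3,4) by blast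
    then show ?thesis by simp
  qed
  have "\<rho> p * \<rho> p * lie_pairing X \<alpha> Y p = lie_pairing X \<alpha> (\<lambda>x. (\<rho> x * \<rho> x) *\<^sub>R Y x) p"
    using lie_pairing_scale[OF Y smooth_fun_on_mult[OF \<rho>(1) \<rho>(1)]] by simp
  also have "\<dots> = (\<Sum>j<rank A. (\<rho> p * \<Phi> p (Y p) j) * lie_pairing X \<alpha> (\<lambda>x. \<rho> x *\<^sub>R frame A \<Phi> j x) p)"
    unfolding eq[symmetric]
    by (intro lie_pairing_sum smooth_cutoff_frame[OF U(1) \<rho>(2,3,1,4)]
        smooth_cutoff_coordinate[OF U(1) \<rho>(2,3,1,4) Y]) auto
  also have "\<dots> = 0" using triv_zero[OF U] assms(2) by simp
  finally show ?thesis using \<rho>(7)[OF \<rho>(6)] by simp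
qed

lemma lie_pairing_pointwise:
  assumes Y: "Y \<in> smooth_sections A" and Z: "Z \<in> smooth_sections A" and "Y p = Z p"
  shows "lie_pairing X \<alpha> Y p = lie_pairing X \<alpha> Z p"
proof -
  have Z': "(\<lambda>x. (- 1) *\<^sub>R Z x) \<in> smooth_sections A"
    by (intro smooth_sections_scale Z smooth_fun_on_const)
  have "lie_pairing X \<alpha> (\<lambda>x. Y x + (- 1) *\<^sub>R Z x) p = 0"
    by (intro lie_pairing_tensorial smooth_sections_add Y Z') (simp add: assms(3))
  then show ?thesis
    using lie_pairing_add[OF Y Z', of p] lie_pairing_scale[OF Z smooth_fun_on_const, of "- 1" p] by simp
qed

text \<open>The value on a vector is read off from a chosen section through it;
  \<open>lie_pairing_pointwise\<close> makes the choice immaterial, and linearity is inherited from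
  linear combinations of sections. For smoothness the frame is replaced near a point by a cutoff
  frame, whose \<open>lie_pairing\<close> is a smooth global function, and the cutoff is then
  divided out.\<close>

lemma lie_derivative_exists:
  "\<exists>\<beta>\<in>dual_sections A. \<forall>Y\<in>smooth_sections A. \<forall>x. pairing \<beta> Y x = lie_pairing X \<alpha> Y x"
proof -
  define S where "S v x = (SOME Y. Y \<in> smooth_sections A \<and> Y x = v)" for v x
  have S: "S v x \<in> smooth_sections A \<and> S v x x = v" if "v \<in> fibre A x" for v x
  proof -
    have "\<exists>Y. Y \<in> smooth_sections A \<and> Y x = v" using section_through[OF that] by blast
    then show ?thesis unfolding S_def by (rule someI_ex)
  qed
  define \<beta> where "\<beta> x v = (if v \<in> fibre A x then lie_pairing X \<alpha> (S v x) x else 0)" for x v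
  have \<beta>: "\<beta> x (Y x) = lie_pairing X \<alpha> Y x" if Y: "Y \<in> smooth_sections A" for Y x
    using lie_pairing_pointwise[of "S (Y x) x" Y x] S[OF smooth_sections_fibre[OF Y]] Y
    by (simp add: \<beta>_def smooth_sections_fibre)
  have dual: "\<beta> x \<in> dual_fibre A x" for x
    unfolding dual_fibre_def
  proof (clarify, intro conjI ballI allI impI)
    fix v w a b assume "v \<in> fibre A x" "w \<in> fibre A x"
    with section_through obtain V W where V: "V \<in> smooth_sections A" "V x = v"
      and W: "W \<in> smooth_sections A" "W x = w"
      by meson
    have s: "(\<lambda>x. a *\<^sub>R V x) \<in> smooth_sections A" "(\<lambda>x. b *\<^sub>R W x) \<in> smooth_sections A"
      by (intro smooth_sections_scale V W smooth_fun_on_const)+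
    show "\<beta> x (a *\<^sub>R v + b *\<^sub>R w) = a * \<beta> x v + b * \<beta> x w"
      unfolding V(2)[symmetric] W(2)[symmetric] \<beta>[OF smooth_sections_add[OF s]]
        \<beta>[OF V(1)] \<beta>[OF W(1)] lie_pairing_add[OF s]
        lie_pairing_scale[OF V(1) smooth_fun_on_const] lie_pairing_scale[OF W(1) smooth_fun_on_const] ..
  qed (simp add: \<beta>_def)
  have "smooth_fun_on A U (\<lambda>x. \<beta> x (frame A \<Phi> j x))" if U: "(U, \<Phi>) \<in> trivs A" and j: "j < rank A"
    for U \<Phi> j
  proof (rule smooth_fun_on_local[OF manifold open_triv[OF U]])
    fix p assume "p \<in> U"
    then obtain \<rho> K N where \<rho>: "smooth_fun A \<rho>" "closed K" "K \<subseteq> U" "\<And>x. x \<notin> K \<Longrightarrow> \<rho> x = 0"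
      "open N" "p \<in> N" "\<And>x. x \<in> N \<Longrightarrow> \<rho> x \<noteq> 0"
      using smooth_bump[OF manifold open_triv[OF U]] by metis
    let ?E = "\<lambda>x. \<rho> x *\<^sub>R frame A \<Phi> j x"
    have E: "?E \<in> smooth_sections A"
      using smooth_cutoff_frame[OF U \<rho>(2,3,1,4) j] .
    have lie_E: "smooth_fun A (lie_pairing X \<alpha> ?E)"
    proof -
      have "smooth_fun A (\<lambda>x. anchor_deriv A X (pairing \<alpha> ?E) x + (- 1) * pairing \<alpha> (bracket A X ?E) x)"
        by (intro smooth_fun_on_add smooth_fun_on_mult smooth_fun_on_const smooth_anchor_deriv
            smooth_pairing X \<alpha> E bracket_section)
      then show ?thesis by (simp add: lie_pairing_def)
    qed
    have "smooth_fun_on A (U \<inter> N) (\<lambda>x. inverse (\<rho> x) * lie_pairing X \<alpha> ?E x)"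
      using \<rho>(7)
      by (intro smooth_fun_on_mult smooth_fun_on_inverse[OF manifold] smooth_fun_imp_on[OF \<rho>(1)]
          smooth_fun_imp_on[OF lie_E]) auto
    then have "smooth_fun_on A (U \<inter> N) (\<lambda>x. \<beta> x (frame A \<Phi> j x))"
    proof (rule smooth_fun_on_cong[OF manifold, rotated])
      fix x assume x: "x \<in> U \<inter> N"
      then have "\<beta> x (?E x) = \<rho> x * \<beta> x (frame A \<Phi> j x)"
        by (intro dual_scale[OF dual] frame_in_fibre[OF U _ j]) simp
      then show "inverse (\<rho> x) * lie_pairing X \<alpha> ?E x = \<beta> x (frame A \<Phi> j x)"
        using \<beta>[OF E, of x] \<rho>(7) x by simp
    qed
    then show "\<exists>N. open N \<and> p \<in> N \<and> smooth_fun_on A (U \<inter> N) (\<lambda>x. \<beta> x (frame A \<Phi> j x))"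
      using \<rho>(5,6) by blast
  qed
  with dual have "\<beta> \<in> dual_sections A" unfolding dual_sections_def by blast
  with \<beta> show ?thesis unfolding pairing_def by blast
qed

lemma
  shows lie_derivative_section: "lie_derivative A X \<alpha> \<in> dual_sections A"
    and lie_derivative_apply:
      "Y \<in> smooth_sections A \<Longrightarrow> lie_derivative A X \<alpha> x (Y x) = lie_pairing X \<alpha> Y x"
proof -
  obtain \<beta> where \<beta>: "\<beta> \<in> dual_sections A"
    "\<And>Y x. Y \<in> smooth_sections A \<Longrightarrow> pairing \<beta> Y x = lie_pairing X \<alpha> Y x"
    using lie_derivative_exists by blast
  have "lie_derivative A X \<alpha> = \<beta>"
    unfolding lie_derivative_def
  proof (rule the_equality)
    show "\<beta> \<in> dual_sections A \<and> (\<forall>Y\<in>smooth_sections A. \<forall>x. pairing \<beta> Y x =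
        anchor_deriv A X (pairing \<alpha> Y) x - pairing \<alpha> (bracket A X Y) x)"
      using \<beta> by (simp add: lie_pairing_def)
    fix \<gamma> assume \<gamma>: "\<gamma> \<in> dual_sections A \<and> (\<forall>Y\<in>smooth_sections A. \<forall>x. pairing \<gamma> Y x =
        anchor_deriv A X (pairing \<alpha> Y) x - pairing \<alpha> (bracket A X Y) x)"
    show "\<gamma> = \<beta>"
    proof
      fix x
      have "\<gamma> x (Y x) = \<beta> x (Y x)" if "Y \<in> smooth_sections A" for Y
        using \<gamma> \<beta>(2)[OF that] that by (simp add: lie_pairing_def pairing_def)
      then show "\<gamma> x = \<beta> x"
        using \<gamma> \<beta>(1) by (intro dual_fibre_eqI) (auto simp: dual_sections_fibre)
    qed
  qed
  with \<beta> show "lie_derivative A X \<alpha> \<in> dual_sections A"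
    "Y \<in> smooth_sections A \<Longrightarrow> lie_derivative A X \<alpha> x (Y x) = lie_pairing X \<alpha> Y x"
    by (auto simp: pairing_def)
qed

end

text \<open>Both sides are covectors at \<open>x\<close>, so it is enough to compare them on
  sections, where anchor and bracket are additive in their first argument. The factors 1 in the
  proof fit the sum to \<open>dual_fibre_lin\<close>.\<close>

lemma lie_derivative_add_left:
  assumes X: "X \<in> smooth_sections A" and Z: "Z \<in> smooth_sections A" and \<alpha>: "\<alpha> \<in> dual_sections A"
  shows "lie_derivative A (\<lambda>x. X x + Z x) \<alpha> x v =
    lie_derivative A X \<alpha> x v + lie_derivative A Z \<alpha> x v"
proof -
  note XZ = smooth_sections_add[OF X Z]
  have "lie_derivative A (\<lambda>x. X x + Z x) \<alpha> x =
      (\<lambda>v. 1 * lie_derivative A X \<alpha> x v + 1 * lie_derivative A Z \<alpha> x v)"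
  proof (rule dual_fibre_eqI)
    show "lie_derivative A (\<lambda>x. X x + Z x) \<alpha> x \<in> dual_fibre A x"
      by (intro dual_sections_fibre lie_derivative_section XZ \<alpha>)
    show "(\<lambda>v. 1 * lie_derivative A X \<alpha> x v + 1 * lie_derivative A Z \<alpha> x v) \<in> dual_fibre A x"
      by (intro dual_fibre_lin dual_sections_fibre lie_derivative_section X Z \<alpha>)
    fix Y assume Y: "Y \<in> smooth_sections A"
    note b = bracket_section[OF X Y] bracket_section[OF Z Y]
    have "lie_pairing (\<lambda>x. X x + Z x) \<alpha> Y x = lie_pairing X \<alpha> Y x + lie_pairing Z \<alpha> Y x"
      unfolding lie_pairing_def bracket_add_left[OF X Z Y]
      using anchor_deriv_add_left[OF X Z smooth_pairing[OF \<alpha> Y]] b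
      by (simp add: pairing_def dual_add[OF dual_sections_fibre[OF \<alpha>]] smooth_sections_fibre)
    then show "lie_derivative A (\<lambda>x. X x + Z x) \<alpha> x (Y x) =
        1 * lie_derivative A X \<alpha> x (Y x) + 1 * lie_derivative A Z \<alpha> x (Y x)"
      using lie_derivative_apply[OF XZ \<alpha> Y] lie_derivative_apply[OF X \<alpha> Y]
        lie_derivative_apply[OF Z \<alpha> Y] by simp
  qed
  then show ?thesis by simp
qed

section \<open>The bracket of covector fields and the polarized Schouten bracket\<close>

lemma differential_dual_fibre: "smooth_fun A f \<Longrightarrow> differential A f x \<in> dual_fibre A x"
  unfolding dual_fibre_def differential_def
  using anchor_combination subspace_fibre[of x] by (auto simp: subspace_add subspace_scale)

lemma differential_add:
  assumes "smooth_fun A f" "smooth_fun A g"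
  shows "differential A (\<lambda>x. f x + g x) x v = differential A f x v + differential A g x v"
proof (cases "v \<in> fibre A x")
  case True
  have "anchor A x v (\<lambda>y. 1 * f y + 1 * g y) = 1 * anchor A x v f + 1 * anchor A x v g"
    using anchor_tangent[OF True] assms unfolding tangent_vectors_def by blast
  then show ?thesis by (simp add: differential_def)
qed (simp add: differential_def)

text \<open>Membership at each point is the form in which \<open>sharp_add\<close> and
  \<open>sharp_skew\<close> ask for their covectors. The differences are written as nested
  combinations with coefficients 1 and -1 to fall under \<open>dual_fibre_lin\<close>.\<close>

lemma biv_bracket_dual_fibre:
  assumes \<pi>: "\<pi> \<in> bivectors A" and \<xi>: "\<xi>1 \<in> dual_sections A" "\<xi>2 \<in> dual_sections A"
  shows "biv_bracket A \<pi> \<xi>1 \<xi>2 x \<in> dual_fibre A x"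
proof -
  have "(\<lambda>v. 1 * (1 * lie_derivative A (sharp A \<pi> \<xi>1) \<xi>2 x v
        + (- 1) * lie_derivative A (sharp A \<pi> \<xi>2) \<xi>1 x v)
        + (- 1) * differential A (\<lambda>y. \<pi> y (\<xi>1 y) (\<xi>2 y)) x v) \<in> dual_fibre A x"
    by (intro dual_fibre_lin differential_dual_fibre smooth_bivector_apply dual_sections_fibre
        lie_derivative_section sharp_section \<pi> \<xi>)
  then show ?thesis by (simp add: biv_bracket_def)
qed

text \<open>Each of the three terms is additive in the bivector: the Lie derivatives because they
  are additive in the vector field and \<open>sharp\<close> is additive in \<pi>, the last term
  because the differential is additive.\<close>

lemma biv_bracket_biv_add:
  assumes \<pi>: "\<pi> \<in> bivectors A" and \<pi>': "\<pi>' \<in> bivectors A"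
    and \<xi>: "\<xi>1 \<in> dual_sections A" "\<xi>2 \<in> dual_sections A"
  shows "biv_bracket A (biv_add \<pi> \<pi>') \<xi>1 \<xi>2 =
    (\<lambda>x v. biv_bracket A \<pi> \<xi>1 \<xi>2 x v + biv_bracket A \<pi>' \<xi>1 \<xi>2 x v)"
proof (intro ext)
  fix x v
  have s: "sharp A (biv_add \<pi> \<pi>') \<eta> = (\<lambda>x. sharp A \<pi> \<eta> x + sharp A \<pi>' \<eta> x)"
    if "\<eta> \<in> dual_sections A" for \<eta>
    using sharp_biv_add[where \<xi> = \<eta>, OF \<pi> \<pi>' dual_sections_fibre[OF that]] by auto
  show "biv_bracket A (biv_add \<pi> \<pi>') \<xi>1 \<xi>2 x v =
      biv_bracket A \<pi> \<xi>1 \<xi>2 x v + biv_bracket A \<pi>' \<xi>1 \<xi>2 x v"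
    unfolding biv_bracket_def s[OF \<xi>(1)] s[OF \<xi>(2)]
    using \<pi> \<pi>' \<xi>
    by (simp add: biv_add_def lie_derivative_add_left sharp_section differential_add
        smooth_bivector_apply)
qed

text \<open>Expanding the square of the sum bilinearly, the terms in \<pi> alone and in \<pi>' alone
  are removed by the two subtracted squares, and the factor 2 of the square cancels the 1/2 of the
  polarization. The case of equal bivectors is included and returns the square itself.\<close>

lemma schouten_eq:
  assumes \<pi>: "\<pi> \<in> bivectors A" and \<pi>': "\<pi>' \<in> bivectors A"
    and \<xi>: "\<xi>1 \<in> dual_sections A" "\<xi>2 \<in> dual_sections A"
  shows "schouten A \<pi> \<pi>' \<xi>1 \<xi>2 x =
    bracket A (sharp A \<pi> \<xi>1) (sharp A \<pi>' \<xi>2) x + bracket A (sharp A \<pi>' \<xi>1) (sharp A \<pi> \<xi>2) x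
    - sharp A \<pi> (biv_bracket A \<pi>' \<xi>1 \<xi>2) x - sharp A \<pi>' (biv_bracket A \<pi> \<xi>1 \<xi>2) x"
proof -
  have s: "sharp A (biv_add \<pi> \<pi>') \<eta> = (\<lambda>x. sharp A \<pi> \<eta> x + sharp A \<pi>' \<eta> x)"
    if "\<And>x. \<eta> x \<in> dual_fibre A x" for \<eta>
    using sharp_biv_add[where \<xi> = \<eta>, OF \<pi> \<pi>' that] by auto
  note S = sharp_section[OF \<pi> \<xi>(1)] sharp_section[OF \<pi> \<xi>(2)]
    sharp_section[OF \<pi>' \<xi>(1)] sharp_section[OF \<pi>' \<xi>(2)]
  let ?B = "biv_bracket A \<pi> \<xi>1 \<xi>2" and ?B' = "biv_bracket A \<pi>' \<xi>1 \<xi>2"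
  note B = biv_bracket_dual_fibre[OF \<pi> \<xi>, of x] biv_bracket_dual_fibre[OF \<pi>' \<xi>, of x]
  have sharp_sum: "sharp A (biv_add \<pi> \<pi>') (\<lambda>x v. ?B x v + ?B' x v) x =
      sharp A \<pi> ?B x + sharp A \<pi> ?B' x + (sharp A \<pi>' ?B x + sharp A \<pi>' ?B' x)"
    using sharp_biv_add[OF \<pi> \<pi>', of "\<lambda>x v. ?B x v + ?B' x v" x] dual_fibre_lin[OF B, of 1 1]
      sharp_add[where \<xi> = ?B and \<eta> = ?B', OF \<pi> B] sharp_add[where \<xi> = ?B and \<eta> = ?B', OF \<pi>' B] by simp
  show ?thesis
    unfolding schouten_def schouten_square_def biv_bracket_biv_add[OF \<pi> \<pi>' \<xi>] sharp_sum
      s[OF dual_sections_fibre[OF \<xi>(1)]] s[OF dual_sections_fibre[OF \<xi>(2)]]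
      bracket_add_left[OF S(1,3) smooth_sections_add[OF S(2,4)]]
      bracket_add_right[OF S(1,2,4)] bracket_add_right[OF S(3,2,4)]
    by (simp add: algebra_simps)
qed

text \<open>Skewness is used on both sides of the hypothesis: pairing \<xi>' with \<pi>'\<eta> is
  minus pairing \<eta> with \<pi>'\<xi>' = \<pi>\<xi>, which is pairing \<xi> with \<pi>\<eta>.
  Since \<open>torsion\<close> is unspecified off the dual relation, this must be known before its
  formula can be used.\<close>

lemma bivector_relation_dual:
  assumes \<pi>: "\<pi> \<in> bivectors A" and \<pi>': "\<pi>' \<in> bivectors A"
    and \<xi>: "\<xi> \<in> dual_sections A" and \<xi>': "\<xi>' \<in> dual_sections A"
    and eq: "sharp A \<pi> \<xi> = sharp A \<pi>' \<xi>'"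
  shows "(\<xi>, \<xi>') \<in> dual_relation A (bivector_relation A \<pi> \<pi>')"
proof -
  have "pairing \<xi>' (sharp A \<pi>' \<eta>) = pairing \<xi> (sharp A \<pi> \<eta>)" if \<eta>: "\<eta> \<in> dual_sections A" for \<eta>
  proof
    fix x
    show "pairing \<xi>' (sharp A \<pi>' \<eta>) x = pairing \<xi> (sharp A \<pi> \<eta>) x"
      using sharp_skew[where \<xi> = \<eta> and \<eta> = \<xi>' and x = x, OF \<pi>' dual_sections_fibre[OF \<eta>] dual_sections_fibre[OF \<xi>']]
        sharp_skew[where \<xi> = \<eta> and \<eta> = \<xi> and x = x, OF \<pi> dual_sections_fibre[OF \<eta>] dual_sections_fibre[OF \<xi>]] eq
      by (simp add: pairing_def)
  qed
  with \<xi> \<xi>' show ?thesis by (auto simp: dual_relation_def bivector_relation_def)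
qed

text \<open>The covector brackets end up evaluated on the images of \<eta>, which is the form into
  which the conditions \<pi>\<xi> = \<pi>'\<xi>' and \<pi>\<xi>' = \<pi>'\<xi>'' can be inserted.
  The plus signs arise because the minus of \<open>schouten_eq\<close> meets the minus of
  \<open>sharp_skew\<close>.\<close>

lemma pairing_schouten:
  assumes \<pi>: "\<pi> \<in> bivectors A" and \<pi>': "\<pi>' \<in> bivectors A"
    and \<xi>: "\<xi>1 \<in> dual_sections A" "\<xi>2 \<in> dual_sections A" and \<eta>: "\<eta> \<in> dual_sections A"
  shows "pairing \<eta> (schouten A \<pi> \<pi>' \<xi>1 \<xi>2) x =
    pairing \<eta> (bracket A (sharp A \<pi> \<xi>1) (sharp A \<pi>' \<xi>2)) x
    + pairing \<eta> (bracket A (sharp A \<pi>' \<xi>1) (sharp A \<pi> \<xi>2)) x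
    + biv_bracket A \<pi>' \<xi>1 \<xi>2 x (sharp A \<pi> \<eta> x) + biv_bracket A \<pi> \<xi>1 \<xi>2 x (sharp A \<pi>' \<eta> x)"
proof -
  note \<eta>x = dual_sections_fibre[OF \<eta>, of x]
  have diff: "\<eta> x (v - w) = \<eta> x v - \<eta> x w" if "v \<in> fibre A x" "w \<in> fibre A x" for v w
    using dual_fibre_combination[OF \<eta>x that, of 1 "- 1"] by simp
  let ?B = "biv_bracket A \<pi> \<xi>1 \<xi>2" and ?B' = "biv_bracket A \<pi>' \<xi>1 \<xi>2"
  note B = biv_bracket_dual_fibre[OF \<pi> \<xi>, of x] biv_bracket_dual_fibre[OF \<pi>' \<xi>, of x]
  have br: "bracket A (sharp A \<pi> \<xi>1) (sharp A \<pi>' \<xi>2) x \<in> fibre A x"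
    "bracket A (sharp A \<pi>' \<xi>1) (sharp A \<pi> \<xi>2) x \<in> fibre A x"
    by (intro smooth_sections_fibre bracket_section sharp_section \<pi> \<pi>' \<xi>)+
  note sB = sharp_in_fibre[where \<xi> = ?B', OF \<pi> B(2)] sharp_in_fibre[where \<xi> = ?B, OF \<pi>' B(1)]
  have "\<eta> x (sharp A \<pi> ?B' x) = - ?B' x (sharp A \<pi> \<eta> x)"
    by (intro sharp_skew \<pi> B \<eta>x)
  moreover have "\<eta> x (sharp A \<pi>' ?B x) = - ?B x (sharp A \<pi>' \<eta> x)"
    by (intro sharp_skew \<pi>' B \<eta>x)
  ultimately show ?thesis
    using br sB subspace_add[OF subspace_fibre br] subspace_diff[OF subspace_fibre]
    by (simp add: pairing_def schouten_eq[OF \<pi> \<pi>' \<xi>] diff dual_add[OF \<eta>x])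
qed

end

theorem theorem2p3:
  fixes A :: "('m::{t2_space, second_countable_topology}, 'e::euclidean_space, 'v::real_vector)
                algebroid_data"
    and \<pi> \<pi>' :: "('m, 'v) bivector_field"
    and \<xi>1 \<xi>2 \<xi> \<xi>' \<xi>'' :: "'m \<Rightarrow> 'v \<Rightarrow> real"
  assumes "lie_algebroid A"
    and "\<pi> \<in> bivectors A" and "\<pi>' \<in> bivectors A"
    and "\<xi>1 \<in> dual_sections A" and "\<xi>2 \<in> dual_sections A"
    and "\<xi> \<in> dual_sections A" and "\<xi>' \<in> dual_sections A" and "\<xi>'' \<in> dual_sections A"
    and "sharp A \<pi> \<xi> = sharp A \<pi>' \<xi>'"
    and "sharp A \<pi> \<xi>' = sharp A \<pi>' \<xi>''"
  shows "\<forall>x. 2 * bivector_torsion A \<pi> \<pi>' \<xi>1 \<xi>2 \<xi> \<xi>' \<xi>'' x =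
           pairing \<xi> (schouten A \<pi> \<pi> \<xi>1 \<xi>2) x
           + pairing \<xi>'' (schouten A \<pi>' \<pi>' \<xi>1 \<xi>2) x
           - 2 * pairing \<xi>' (schouten A \<pi> \<pi>' \<xi>1 \<xi>2) x"
proof -
  interpret algebroid A using assms(1) by unfold_locales
  note \<pi> = assms(2) and \<pi>' = assms(3) and \<xi>12 = assms(4,5)
  note dual = bivector_relation_dual[OF \<pi> \<pi>' assms(6,7,9)]
    bivector_relation_dual[OF \<pi> \<pi>' assms(7,8,10)]
  have rel: "(sharp A \<pi>' \<xi>1, sharp A \<pi> \<xi>1) \<in> bivector_relation A \<pi> \<pi>'"
    "(sharp A \<pi>' \<xi>2, sharp A \<pi> \<xi>2) \<in> bivector_relation A \<pi> \<pi>'"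
    using assms(4,5) by (auto simp: bivector_relation_def)
  have add: "pairing \<xi>' (\<lambda>y. bracket A (sharp A \<pi> \<xi>1) (sharp A \<pi>' \<xi>2) y
        + bracket A (sharp A \<pi>' \<xi>1) (sharp A \<pi> \<xi>2) y) x =
      pairing \<xi>' (bracket A (sharp A \<pi> \<xi>1) (sharp A \<pi>' \<xi>2)) x
        + pairing \<xi>' (bracket A (sharp A \<pi>' \<xi>1) (sharp A \<pi> \<xi>2)) x" for x
    unfolding pairing_def
    by (rule dual_add[OF dual_sections_fibre[OF assms(7)] smooth_sections_fibre smooth_sections_fibre])
      (intro bracket_section sharp_section assms)+
  \<comment> \<open>The brackets of sections make up twice the torsion. With \<open>B\<close> and
    \<open>B'\<close> for the covector brackets of \<pi> and \<pi>', the remainder is \<open>2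
    B(\<pi>\<xi>) + 2 B'(\<pi>'\<xi>'') - 2 B'(\<pi>\<xi>') - 2 B(\<pi>'\<xi>')\<close>, and each of
    the two conditions cancels one pair.\<close>
  show ?thesis
    unfolding bivector_torsion_def torsion_def
    using rel dual assms(9,10)
    by (simp add: add pairing_schouten[OF \<pi> \<pi> \<xi>12 assms(6)] pairing_schouten[OF \<pi>' \<pi>' \<xi>12 assms(8)]
        pairing_schouten[OF \<pi> \<pi>' \<xi>12 assms(7)])
qed

end
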